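(* Let $(M,g)=(B\times_f F,\ g_B+f^2g_F)$ be a warped product manifold with $m_1=\dim B$, let $(\overline{M},\overline{g})=(\overline{M}(c),E,\overline{g})$ be a quaternionic space form of constant quaternionic sectional curvature $c$, and let $\psi:(M,g)\to(\overline{M},\overline{g})$ be an isometric immersion. Assume that $(M,g)$ is a totally geodesic totally real submanifold of $(\overline{M},\overline{g})$ (i.e., $J_\alpha(TM)\subset TM^{\perp}$ for all $\alpha\in\{1,2,3\}$). Then $$m_1\frac{c}{4}\ \le\ \frac{\triangle f}{f}\ \le\ m_1\frac{c}{4}.$$
   Context: $(B,g_B)$ and $(F,g_F)$ are Riemannian manifolds (of positive dimension), $f:B\to\mathbb{R}^+$ is a smooth positive function (the warping function), and $B\times_f F$ is the product $B\times F$ with the metric $g=g_B+f^2g_F$; $f$ is also regarded as a function on $M$ via the projection to $B$. All dimensions are real. The Laplacian is $\triangle f=\sum_i\big((\nabla_{v_i}v_i)f-v_i^2f\big)$ for a local orthonormal frame $\{v_i\}$ of $TM$, where $\nabla$ is the Levi-Civita connection of $M$ (note the sign). Totally geodesic means that the second fundamental form of the immersion vanishes identically; $TM^\perp$ is the normal bundle. A quaternionic space form $(\overline{M}(c),E,\overline{g})$ is a quaternionic Kähler manifold, where $E\subset\mathrm{End}(T\overline{M})$ is the rank-3 bundle locally spanned by almost Hermitian structures $J_1,J_2,J_3$ satisfying the quaternion relations, of constant quaternionic sectional curvature $c$; its curvature tensor is $$\overline{R}(X,Y)Z=\tfrac{c}{4}\Big(\overline{g}(Y,Z)X-\overline{g}(X,Z)Y+\sum_{\alpha=1}^3\big(\overline{g}(J_\alpha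 Y,Z)J_\alpha X-\overline{g}(J_\alpha X,Z)J_\alpha Y-2\overline{g}(J_\alpha X,Y)J_\alpha Z\big)\Big).$$
   Formalization: Here △f is the Laplacian of f on the base (B,g_B), not on M as the context says; with the Laplacian of M the claim fails, e.g. for R^n minus 0 = (0,∞)×_r S^{n-1} in flat H^n (n ≥ 2), where △f/f = -(n-1)/r² while c = 0. *)

theory Defs
  imports "HOL-Analysis.Analysis"
begin

section \<open>Smooth maps between Euclidean spaces\<close>

primrec times_diff_on ::
    "nat \<Rightarrow> 'a::real_normed_vector set \<Rightarrow> ('a \<Rightarrow> 'b::real_normed_vector) \<Rightarrow> bool" where
  "times_diff_on 0 S f \<longleftrightarrow> continuous_on S f"
| "times_diff_on (Suc n) S f \<longleftrightarrow>
     (\<forall>x\<in>S. f differentiable (at x)) \<and>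
     (\<forall>v. times_diff_on n S (\<lambda>x. frechet_derivative f (at x) v))"

text \<open>To be used for open \<open>S\<close> in a finite-dimensional space, where it is \<open>C\<^sup>\<infinity>\<close>.\<close>

definition smooth_on ::
    "'a::real_normed_vector set \<Rightarrow> ('a \<Rightarrow> 'b::real_normed_vector) \<Rightarrow> bool" where
  "smooth_on S f \<longleftrightarrow> (\<forall>n. times_diff_on n S f)"

text \<open>Derivative of a (scalar or vector valued) function along a vector field.\<close>

definition dir_deriv ::
    "('a::real_normed_vector \<Rightarrow> 'a) \<Rightarrow> ('a \<Rightarrow> 'b::real_normed_vector) \<Rightarrow> 'a \<Rightarrow> 'b" where
  "dir_deriv X h = (\<lambda>x. frechet_derivative h (at x) (X x))"


section \<open>Smooth manifolds\<close>

text \<open>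
  A manifold is a Hausdorff second countable type together with an atlas, i.e. a family
  \<open>(U\<^sub>i, \<phi>\<^sub>i)\<close> of charts indexed by a type, with values in a Euclidean space of
  dimension \<open>DIM('a)\<close> (which is always positive).  The atlas need not be maximal.
  Tensor fields are families of local components, one for each chart, which
  are related by the transformation law under changes of charts; the components for
  the chart \<open>i\<close> are functions of the coordinates, that is of points of \<open>\<phi>\<^sub>i(U\<^sub>i)\<close>, and
  they are irrelevant outside that set.
\<close>

type_synonym ('i, 'm, 'a) atlas = "'i \<Rightarrow> 'm set \<times> ('m \<Rightarrow> 'a)"

definition chart_image :: "('i, 'm, 'a) atlas \<Rightarrow> 'i \<Rightarrow> 'a set" where
  "chart_image A i = snd (A i) ` fst (A i)"

definition chart_inv :: "('i, 'm, 'a) atlas \<Rightarrow> 'i \<Rightarrow> 'a \<Rightarrow> 'm" where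
  "chart_inv A i = inv_into (fst (A i)) (snd (A i))"

text \<open>The local representative \<open>\<phi>'\<^sub>j \<circ> \<psi> \<circ> \<phi>\<^sub>i\<^sup>-\<^sup>1\<close> of a map \<open>\<psi>\<close> and its domain
  \<open>\<phi>\<^sub>i(U\<^sub>i \<inter> \<psi>\<^sup>-\<^sup>1(U'\<^sub>j))\<close>.\<close>

definition local_rep ::
    "('i, 'm, 'a) atlas \<Rightarrow> ('j, 'n, 'b) atlas \<Rightarrow> ('m \<Rightarrow> 'n) \<Rightarrow> 'i \<Rightarrow> 'j \<Rightarrow> 'a \<Rightarrow> 'b" where
  "local_rep A A' \<psi> i j = snd (A' j) \<circ> \<psi> \<circ> chart_inv A i"

definition local_dom ::
    "('i, 'm, 'a) atlas \<Rightarrow> ('j, 'n, 'b) atlas \<Rightarrow> ('m \<Rightarrow> 'n) \<Rightarrow> 'i \<Rightarrow> 'j \<Rightarrow> 'a set" where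
  "local_dom A A' \<psi> i j = snd (A i) ` (fst (A i) \<inter> \<psi> -` fst (A' j))"

definition smooth_manifold ::
    "('i, 'm::{t2_space,second_countable_topology}, 'a::euclidean_space) atlas \<Rightarrow> bool" where
  "smooth_manifold A \<longleftrightarrow>
     (\<forall>i. open (fst (A i)) \<and> open (chart_image A i) \<and>
          (\<exists>\<theta>. homeomorphism (fst (A i)) (chart_image A i) (snd (A i)) \<theta>)) \<and>
     (\<Union>i. fst (A i)) = UNIV \<and>
     (\<forall>i j. smooth_on (local_dom A A id i j) (local_rep A A id i j))"

definition smooth_map ::
    "('i, 'm::topological_space, 'a::euclidean_space) atlas \<Rightarrow>
     ('j, 'n::topological_space, 'b::euclidean_space) atlas \<Rightarrow> ('m \<Rightarrow> 'n) \<Rightarrow> bool" where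
  "smooth_map A A' \<psi> \<longleftrightarrow> continuous_on UNIV \<psi> \<and>
     (\<forall>i j. smooth_on (local_dom A A' \<psi> i j) (local_rep A A' \<psi> i j))"

definition smooth_fun :: "('i, 'm, 'a::euclidean_space) atlas \<Rightarrow> ('m \<Rightarrow> real) \<Rightarrow> bool" where
  "smooth_fun A h \<longleftrightarrow> (\<forall>i. smooth_on (chart_image A i) (h \<circ> chart_inv A i))"

definition prod_atlas ::
    "('i, 'm, 'a) atlas \<Rightarrow> ('j, 'n, 'b) atlas \<Rightarrow> ('i \<times> 'j, 'm \<times> 'n, 'a \<times> 'b) atlas" where
  "prod_atlas A A' = (\<lambda>(i, j). (fst (A i) \<times> fst (A' j), map_prod (snd (A i)) (snd (A' j))))"


section \<open>Riemannian metrics in coordinates\<close>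

type_synonym 'a metric = "'a \<Rightarrow> 'a \<Rightarrow> 'a \<Rightarrow> real"

definition local_metric :: "'a::euclidean_space set \<Rightarrow> 'a metric \<Rightarrow> bool" where
  "local_metric U G \<longleftrightarrow>
     (\<forall>x\<in>U. bilinear (G x) \<and> (\<forall>v w. G x v w = G x w v) \<and> (\<forall>v. v \<noteq> 0 \<longrightarrow> 0 < G x v v)) \<and>
     (\<forall>v w. smooth_on U (\<lambda>x. G x v w))"

text \<open>The Levi-Civita connection: the unique torsion-free (i.e. symmetric in coordinates)
  metric connection, with \<open>christoffel G x v w = \<Gamma>\<^sub>x(v, w)\<close>.\<close>

definition christoffel :: "'a::euclidean_space metric \<Rightarrow> 'a \<Rightarrow> 'a \<Rightarrow> 'a \<Rightarrow> 'a" where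
  "christoffel G x = (THE \<Gamma>. bilinear \<Gamma> \<and> (\<forall>u v. \<Gamma> u v = \<Gamma> v u) \<and>
     (\<forall>u v w. frechet_derivative (\<lambda>y. G y v w) (at x) u = G x (\<Gamma> u v) w + G x v (\<Gamma> u w)))"

definition cov_deriv ::
    "'a::euclidean_space metric \<Rightarrow> ('a \<Rightarrow> 'a) \<Rightarrow> ('a \<Rightarrow> 'a) \<Rightarrow> 'a \<Rightarrow> 'a" where
  "cov_deriv G X Y = (\<lambda>x. dir_deriv X Y x + christoffel G x (X x) (Y x))"

text \<open>\<open>R(u,v)w = \<nabla>\<^sub>u\<nabla>\<^sub>vw - \<nabla>\<^sub>v\<nabla>\<^sub>uw - \<nabla>\<^bsub>[u,v]\<^esub>w\<close>, evaluated on the extensions of the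
  vectors to coordinate-constant fields, for which \<open>[u,v] = 0\<close>.\<close>

definition curvature ::
    "'a::euclidean_space metric \<Rightarrow> 'a \<Rightarrow> 'a \<Rightarrow> 'a \<Rightarrow> 'a \<Rightarrow> 'a" where
  "curvature G x u v w =
     cov_deriv G (\<lambda>_. u) (cov_deriv G (\<lambda>_. v) (\<lambda>_. w)) x -
     cov_deriv G (\<lambda>_. v) (cov_deriv G (\<lambda>_. u) (\<lambda>_. w)) x"

definition sectional_curvature ::
    "'a::euclidean_space metric \<Rightarrow> 'a \<Rightarrow> 'a \<Rightarrow> 'a \<Rightarrow> real" where
  "sectional_curvature G x u v =
     G x (curvature G x u v v) u / (G x u u * G x v v - (G x u v)\<^sup>2)"

definition orthonormal_frame ::
    "'a::euclidean_space metric \<Rightarrow> 'a set \<Rightarrow> (nat \<Rightarrow> 'a \<Rightarrow> 'a) \<Rightarrow> bool" where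
  "orthonormal_frame G W e \<longleftrightarrow> (\<forall>k<DIM('a). smooth_on W (e k)) \<and>
     (\<forall>x\<in>W. \<forall>k<DIM('a). \<forall>l<DIM('a). G x (e k x) (e l x) = (if k = l then 1 else 0))"

definition frame_laplacian ::
    "'a::euclidean_space metric \<Rightarrow> (nat \<Rightarrow> 'a \<Rightarrow> 'a) \<Rightarrow> ('a \<Rightarrow> real) \<Rightarrow> 'a \<Rightarrow> real" where
  "frame_laplacian G e h x =
     (\<Sum>k<DIM('a). dir_deriv (cov_deriv G (e k) (e k)) h x - dir_deriv (e k) (dir_deriv (e k) h) x)"


section \<open>Riemannian manifolds\<close>

definition riemannian_manifold ::
    "('i, 'm::{t2_space,second_countable_topology}, 'a::euclidean_space) atlas \<Rightarrow>
     ('i \<Rightarrow> 'a metric) \<Rightarrow> bool" where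
  "riemannian_manifold A g \<longleftrightarrow> smooth_manifold A \<and>
     (\<forall>i. local_metric (chart_image A i) (g i)) \<and>
     (\<forall>i j. \<forall>x\<in>local_dom A A id i j. \<forall>v w.
        g i x v w =
        g j (local_rep A A id i j x)
          (frechet_derivative (local_rep A A id i j) (at x) v)
          (frechet_derivative (local_rep A A id i j) (at x) w))"

text \<open>The value at \<open>p\<close> does not depend on the chart nor on the local orthonormal frame.\<close>

definition laplacian ::
    "('i, 'm::topological_space, 'a::euclidean_space) atlas \<Rightarrow> ('i \<Rightarrow> 'a metric) \<Rightarrow>
     ('m \<Rightarrow> real) \<Rightarrow> 'm \<Rightarrow> real" where
  "laplacian A g h p = (THE l. \<forall>i W e.
     p \<in> fst (A i) \<and> open W \<and> W \<subseteq> chart_image A i \<and> snd (A i) p \<in> W \<and>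
     orthonormal_frame (g i) W e \<longrightarrow>
       l = frame_laplacian (g i) e (h \<circ> chart_inv A i) (snd (A i) p))"

definition warped_metric ::
    "('i, 'm, 'a) atlas \<Rightarrow> ('i \<Rightarrow> 'a metric) \<Rightarrow> ('m \<Rightarrow> real) \<Rightarrow> ('j \<Rightarrow> 'b metric) \<Rightarrow>
     'i \<times> 'j \<Rightarrow> ('a \<times> 'b) metric" where
  "warped_metric A gB f gF = (\<lambda>(i, j) (x, y) (v, w) (v', w').
     gB i x v v' + (f (chart_inv A i x))\<^sup>2 * gF j y w w')"


section \<open>Isometric immersions\<close>

definition isometric_immersion ::
    "('i, 'm::topological_space, 'a::euclidean_space) atlas \<Rightarrow> ('i \<Rightarrow> 'a metric) \<Rightarrow>
     ('j, 'n::topological_space, 'b::euclidean_space) atlas \<Rightarrow> ('j \<Rightarrow> 'b metric) \<Rightarrow>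
     ('m \<Rightarrow> 'n) \<Rightarrow> bool" where
  "isometric_immersion A g A' g' \<psi> \<longleftrightarrow> smooth_map A A' \<psi> \<and>
     (\<forall>i j. \<forall>x\<in>local_dom A A' \<psi> i j.
        inj (frechet_derivative (local_rep A A' \<psi> i j) (at x)) \<and>
        (\<forall>v w. g' j (local_rep A A' \<psi> i j x)
                 (frechet_derivative (local_rep A A' \<psi> i j) (at x) v)
                 (frechet_derivative (local_rep A A' \<psi> i j) (at x) w) = g i x v w))"

text \<open>The Gauss formula \<open>h(X,Y) = \<nabla>'\<^sub>X(\<psi>\<^sub>*Y) - \<psi>\<^sub>*(\<nabla>\<^sub>XY)\<close>, where \<open>\<nabla>'\<close> is the connection of the
  ambient space, evaluated on coordinate-constant fields \<open>X = u\<close>, \<open>Y = v\<close>; here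
  \<open>\<Psi>\<close> is a local representative of \<open>\<psi>\<close>.\<close>

definition second_fundamental_form ::
    "'a::euclidean_space metric \<Rightarrow> 'b::euclidean_space metric \<Rightarrow> ('a \<Rightarrow> 'b) \<Rightarrow>
     'a \<Rightarrow> 'a \<Rightarrow> 'a \<Rightarrow> 'b" where
  "second_fundamental_form G G' \<Psi> x u v =
     (let d = (\<lambda>y. frechet_derivative \<Psi> (at y)) in
      dir_deriv (\<lambda>_. u) (\<lambda>y. d y v) x + christoffel G' (\<Psi> x) (d x u) (d x v) -
      d x (cov_deriv G (\<lambda>_. u) (\<lambda>_. v) x))"

definition totally_geodesic ::
    "('i, 'm::topological_space, 'a::euclidean_space) atlas \<Rightarrow> ('i \<Rightarrow> 'a metric) \<Rightarrow>
     ('j, 'n::topological_space, 'b::euclidean_space) atlas \<Rightarrow> ('j \<Rightarrow> 'b metric) \<Rightarrow>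
     ('m \<Rightarrow> 'n) \<Rightarrow> bool" where
  "totally_geodesic A g A' g' \<psi> \<longleftrightarrow>
     (\<forall>i j. \<forall>x\<in>local_dom A A' \<psi> i j. \<forall>u v.
        second_fundamental_form (g i) (g' j) (local_rep A A' \<psi> i j) x u v = 0)"

definition normal_space ::
    "'b::euclidean_space metric \<Rightarrow> ('a::euclidean_space \<Rightarrow> 'b) \<Rightarrow> 'a \<Rightarrow> 'b set" where
  "normal_space G' \<Psi> x = {n. \<forall>v. G' (\<Psi> x) n (frechet_derivative \<Psi> (at x) v) = 0}"


section \<open>Quaternionic space forms\<close>

text \<open>\<open>J 1, J 2, J 3\<close> are local almost Hermitian structures on \<open>W\<close> satisfying the quaternion
  relations and spanning the bundle with fibre \<open>Q y\<close> at \<open>y\<close>.\<close>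

definition quaternionic_basis ::
    "'a::euclidean_space metric \<Rightarrow> ('a \<Rightarrow> ('a \<Rightarrow>\<^sub>L 'a) set) \<Rightarrow> 'a set \<Rightarrow>
     (nat \<Rightarrow> 'a \<Rightarrow> 'a \<Rightarrow>\<^sub>L 'a) \<Rightarrow> bool" where
  "quaternionic_basis G Q W J \<longleftrightarrow>
     (\<forall>\<alpha>\<in>{1..3}. smooth_on W (J \<alpha>)) \<and>
     (\<forall>y\<in>W.
        (\<forall>\<alpha>\<in>{1..3}. J \<alpha> y o\<^sub>L J \<alpha> y = - id_blinfun \<and>
           (\<forall>u v. G y (J \<alpha> y u) (J \<alpha> y v) = G y u v)) \<and>
        (\<forall>(\<alpha>, \<beta>, \<gamma>) \<in> {(1, 2, 3), (2, 3, 1), (3, 1, 2)}.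
           J \<alpha> y o\<^sub>L J \<beta> y = J \<gamma> y \<and> J \<beta> y o\<^sub>L J \<alpha> y = - J \<gamma> y) \<and>
        Q y = span {J 1 y, J 2 y, J 3 y})"

text \<open>The last condition says that \<open>E\<close> is parallel:
  \<open>(\<nabla>\<^sub>uS)v = \<nabla>\<^sub>u(Sv) - S(\<nabla>\<^sub>uv)\<close> defines an element of \<open>E\<close> for each local section \<open>S\<close> of \<open>E\<close>.\<close>

definition quaternionic_kaehler ::
    "('i, 'm::{t2_space,second_countable_topology}, 'a::euclidean_space) atlas \<Rightarrow>
     ('i \<Rightarrow> 'a \<Rightarrow> ('a \<Rightarrow>\<^sub>L 'a) set) \<Rightarrow> ('i \<Rightarrow> 'a metric) \<Rightarrow> bool" where
  "quaternionic_kaehler A E g \<longleftrightarrow> riemannian_manifold A g \<and>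
     (\<forall>i j. \<forall>x\<in>local_dom A A id i j. \<forall>K\<in>E i x. \<exists>K'\<in>E j (local_rep A A id i j x). \<forall>v.
        frechet_derivative (local_rep A A id i j) (at x) (K v) =
        K' (frechet_derivative (local_rep A A id i j) (at x) v)) \<and>
     (\<forall>i. \<forall>x\<in>chart_image A i. \<exists>W J. open W \<and> W \<subseteq> chart_image A i \<and> x \<in> W \<and>
        quaternionic_basis (g i) (E i) W J) \<and>
     (\<forall>i W S. open W \<and> W \<subseteq> chart_image A i \<and> smooth_on W S \<and> (\<forall>y\<in>W. S y \<in> E i y) \<longrightarrow>
        (\<forall>x\<in>W. \<forall>u. \<exists>K\<in>E i x. \<forall>v.
           cov_deriv (g i) (\<lambda>_. u) (\<lambda>y. S y v) x - S x (cov_deriv (g i) (\<lambda>_. u) (\<lambda>_. v) x) = K v))"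

text \<open>The quaternionic section \<open>Q(u) = span {u, J\<^sub>1u, J\<^sub>2u, J\<^sub>3u}\<close>; the quaternionic sectional
  curvature is constant if all planes in all quaternionic sections have the same curvature.\<close>

definition quaternionic_section :: "('a::euclidean_space \<Rightarrow>\<^sub>L 'a) set \<Rightarrow> 'a \<Rightarrow> 'a set" where
  "quaternionic_section Q u = span (insert u ((\<lambda>K. blinfun_apply K u) ` Q))"

definition constant_quaternionic_curvature ::
    "('i, 'm, 'a::euclidean_space) atlas \<Rightarrow> ('i \<Rightarrow> 'a \<Rightarrow> ('a \<Rightarrow>\<^sub>L 'a) set) \<Rightarrow>
     ('i \<Rightarrow> 'a metric) \<Rightarrow> real \<Rightarrow> bool" where
  "constant_quaternionic_curvature A E g c \<longleftrightarrow>
     (\<forall>i. \<forall>x\<in>chart_image A i. \<forall>u. u \<noteq> 0 \<longrightarrow>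
        (\<forall>v\<in>quaternionic_section (E i x) u. \<forall>w\<in>quaternionic_section (E i x) u.
           v \<noteq> w \<and> independent {v, w} \<longrightarrow> sectional_curvature (g i) x v w = c))"

definition quaternionic_space_form ::
    "('i, 'm::{t2_space,second_countable_topology}, 'a::euclidean_space) atlas \<Rightarrow>
     ('i \<Rightarrow> 'a \<Rightarrow> ('a \<Rightarrow>\<^sub>L 'a) set) \<Rightarrow> ('i \<Rightarrow> 'a metric) \<Rightarrow> real \<Rightarrow> bool" where
  "quaternionic_space_form A E g c \<longleftrightarrow>
     quaternionic_kaehler A E g \<and>
     constant_quaternionic_curvature A E g c \<and>
     (\<forall>i W J. open W \<and> W \<subseteq> chart_image A i \<and> quaternionic_basis (g i) (E i) W J \<longrightarrow>
        (\<forall>x\<in>W. \<forall>u v w.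
           curvature (g i) x u v w = (c / 4) *\<^sub>R
             (g i x v w *\<^sub>R u - g i x u w *\<^sub>R v +
              (\<Sum>\<alpha>=1..3.
                 g i x (J \<alpha> x v) w *\<^sub>R J \<alpha> x u - g i x (J \<alpha> x u) w *\<^sub>R J \<alpha> x v
                 - (2 * g i x (J \<alpha> x u) v) *\<^sub>R J \<alpha> x w))))"

definition totally_real ::
    "('i, 'm::topological_space, 'a::euclidean_space) atlas \<Rightarrow>
     ('j, 'n::topological_space, 'b::euclidean_space) atlas \<Rightarrow>
     ('j \<Rightarrow> 'b \<Rightarrow> ('b \<Rightarrow>\<^sub>L 'b) set) \<Rightarrow> ('j \<Rightarrow> 'b metric) \<Rightarrow> ('m \<Rightarrow> 'n) \<Rightarrow> bool" where
  "totally_real A A' E g' \<psi> \<longleftrightarrow>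
     (\<forall>i j W J. open W \<and> W \<subseteq> chart_image A' j \<and> quaternionic_basis (g' j) (E j) W J \<longrightarrow>
        (\<forall>x\<in>local_dom A A' \<psi> i j. local_rep A A' \<psi> i j x \<in> W \<longrightarrow>
           (\<forall>\<alpha>\<in>{1..3}.
              blinfun_apply (J \<alpha> (local_rep A A' \<psi> i j x)) `
                range (frechet_derivative (local_rep A A' \<psi> i j) (at x))
              \<subseteq> normal_space (g' j) (local_rep A A' \<psi> i j) x)))"

end

theory Submission
  imports Defs
begin

text \<open>
  For \<open>X = (a, 0)\<close> and \<open>Z = (0, w)\<close> the curvature of the warped product is
  \<open>R(Z, X)X = -(Hess f (a, a) / f) Z\<close>.  The Gauss equation of a totally geodesic immersion says that
  the differential of \<open>\<psi>\<close> carries this to the ambient curvature, in which all \<open>J\<^sub>\<alpha>\<close>-terms vanish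
  because the immersion is totally real; what is left is \<open>c/4 g\<^sub>B(a, a) Z\<close>.  Hence
  \<open>- Hess f = (c/4) f g\<^sub>B\<close>, and the trace over any orthonormal frame of \<open>B\<close> gives
  \<open>\<triangle>f = m\<^sub>1 (c/4) f\<close>.
\<close>

section \<open>Calculus of smooth functions\<close>

text \<open>Both \<open>christoffel\<close> and \<open>laplacian\<close> are definite descriptions,
  so existence and uniqueness must be established before either can be computed. Smooth orthonormal
  frames settle existence in both cases. Independence of the Laplacian from chart and frame then
  comes for free: the Hessian identity holds in every chart and prescribes the same value for every
  admissible frame. The argument is local, in charts around \<open>p\<close>, an arbitrary fibre
  point \<open>q\<close> and \<open>\<psi> (p, q)\<close>. The fibre enters through a single nonzero
  vertical vector, available because model spaces have positive dimension. The diagonal values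
  \<open>Hess f (a, a)\<close> suffice, since \<open>frame_laplacian\<close> is minus the sum of
  these values over the frame. The Gauss equation involves third derivatives of a local
  representative. This is why symmetry of second derivatives and a product rule for moving linear
  maps are prepared first.\<close>

abbreviation fd :: "('a::real_normed_vector \<Rightarrow> 'b::real_normed_vector) \<Rightarrow> 'a \<Rightarrow> 'a \<Rightarrow> 'b" where
  "fd f x \<equiv> frechet_derivative f (at x)"

lemma fd_eqI: "(f has_derivative f') (at x) \<Longrightarrow> fd f x = f'"
  by (rule frechet_derivative_at[symmetric])

lemma fd_works: "f differentiable (at x) \<Longrightarrow> (f has_derivative fd f x) (at x)"
  by (simp add: frechet_derivative_works)

text \<open>A Frechet derivative depends on values near the point. Since \<open>S\<close> is open,
  agreement on \<open>S\<close> is agreement near each of its points, so the induction passes to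
  derivatives.\<close>

lemma times_diff_on_cong:
  assumes "open S" "times_diff_on n S f" "\<And>x. x \<in> S \<Longrightarrow> f x = g x"
  shows "times_diff_on n S g"
  using assms(2,3)
proof (induction n arbitrary: f g)
  case 0
  then show ?case by (simp cong: continuous_on_cong)
next
  case (Suc n)
  have g: "(g has_derivative fd f x) (at x)" if "x \<in> S" for x
    using Suc.prems that assms(1)
    by (intro has_derivative_transform_within_open[OF fd_works]) auto
  have "times_diff_on n S (\<lambda>x. fd g x v)" for v
    by (rule Suc.IH[of "\<lambda>x. fd f x v"]) (use Suc.prems fd_eqI[OF g] in auto)
  with g show ?case by (auto simp: differentiable_def)
qed

lemma times_diff_on_SucD: "times_diff_on (Suc n) S f \<Longrightarrow> times_diff_on n S f"
proof (induction n arbitrary: f)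
  case 0
  then show ?case
    by (auto intro!: differentiable_imp_continuous_on differentiable_at_imp_differentiable_on)
qed (use times_diff_on.simps(2) in blast)

text \<open>Lets an explicitly computed derivative stand in for \<open>frechet_derivative\<close>;
  this is the induction step of the closure properties below.\<close>

lemma times_diff_on_SucI:
  assumes "open S" "\<And>x. x \<in> S \<Longrightarrow> (f has_derivative f' x) (at x)"
    "\<And>v. times_diff_on n S (\<lambda>x. f' x v)"
  shows "times_diff_on (Suc n) S f"
proof -
  have "times_diff_on n S (\<lambda>x. fd f x v)" for v
    by (rule times_diff_on_cong[OF assms(1) assms(3)]) (use fd_eqI[OF assms(2)] in auto)
  with assms(2) show ?thesis by (auto simp: differentiable_def)
qed

lemma times_diff_on_const: "times_diff_on n S (\<lambda>x. c)"
  by (induction n arbitrary: c) auto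

lemma times_diff_on_add:
  assumes "open S" "times_diff_on n S f" "times_diff_on n S g"
  shows "times_diff_on n S (\<lambda>x. f x + g x)"
  using assms(2,3)
proof (induction n arbitrary: f g)
  case (Suc n)
  show ?case
    by (rule times_diff_on_SucI[OF assms(1), where f' = "\<lambda>x v. fd f x v + fd g x v"])
      (use Suc in \<open>auto intro!: has_derivative_add fd_works\<close>)
qed (auto intro: continuous_on_add)

text \<open>One Leibniz induction covers products, scalar multiples and inner products. In each
  summand of the derivative one factor is undifferentiated, so its order has to be lowered by
  \<open>times_diff_on_SucD\<close>.\<close>

lemma times_diff_on_bilinear:
  assumes "bounded_bilinear pr" "open S" "times_diff_on n S f" "times_diff_on n S g"
  shows "times_diff_on n S (\<lambda>x. pr (f x) (g x))"
  using assms(3,4)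
proof (induction n arbitrary: f g)
  case 0
  then show ?case by (simp add: bounded_bilinear.continuous_on[OF assms(1)])
next
  case (Suc n)
  show ?case
    by (rule times_diff_on_SucI[OF assms(2),
          where f' = "\<lambda>x v. pr (f x) (fd g x v) + pr (fd f x v) (g x)"])
      (use Suc times_diff_on_SucD[OF Suc.prems(1)] times_diff_on_SucD[OF Suc.prems(2)] in
        \<open>auto intro!: bounded_bilinear.FDERIV[OF assms(1)] fd_works times_diff_on_add[OF assms(2)]\<close>)
qed

text \<open>The exponent has to be arbitrary, since differentiation lowers it by one.\<close>

lemma times_diff_on_powr:
  fixes f :: "'a::real_normed_vector \<Rightarrow> real"
  assumes "open S" "times_diff_on n S f" "\<And>x. x \<in> S \<Longrightarrow> 0 < f x"
  shows "times_diff_on n S (\<lambda>x. f x powr a)"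
  using assms(2)
proof (induction n arbitrary: a)
  case 0
  then show ?case using assms(3) by (force intro!: continuous_intros)
next
  case (Suc n)
  have f: "(f has_derivative fd f x) (at x)" if "x \<in> S" for x
    using Suc.prems that by (intro fd_works) auto
  show ?case
  proof (rule times_diff_on_SucI[OF assms(1)])
    show "((\<lambda>x. f x powr a) has_derivative (\<lambda>v. (a * f x powr (a - 1)) * fd f x v)) (at x)"
      if "x \<in> S" for x
    proof -
      have "((\<lambda>y. y powr a) has_derivative (*) (a * f x powr (a - 1))) (at (f x))"
        using has_real_derivative_powr[OF assms(3)[OF that], of a]
        by (simp add: has_field_derivative_def)
      from diff_chain_at[OF f[OF that] this] show ?thesis by (simp add: o_def)
    qed
    show "times_diff_on n S (\<lambda>x. a * f x powr (a - 1) * fd f x v)" for v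
      using Suc.prems Suc.IH[OF times_diff_on_SucD[OF Suc.prems]]
      by (intro times_diff_on_bilinear[OF bounded_bilinear_mult assms(1)] times_diff_on_const) auto
  qed
qed

text \<open>Meant for the projections of a product chart. As \<open>L\<close> is its own derivative,
  differentiating gives \<open>fd f (L x) (L v)\<close> with the fixed direction \<open>L v\<close>,
  again a function composed with \<open>L\<close>.\<close>

lemma times_diff_on_compose_linear:
  assumes "bounded_linear L" "open T" "L ` T \<subseteq> S" "times_diff_on n S f"
  shows "times_diff_on n T (\<lambda>x. f (L x))"
  using assms(4)
proof (induction n arbitrary: f)
  case 0
  then show ?case
    using continuous_on_compose2[of S f T L] assms(1,3)
    by (auto simp: linear_continuous_on)
next
  case (Suc n)
  have "((\<lambda>x. f (L x)) has_derivative (\<lambda>v. fd f (L x) (L v))) (at x)" if "x \<in> T" for x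
  proof -
    have "(f has_derivative fd f (L x)) (at (L x))"
      using Suc.prems assms(3) that by (intro fd_works) auto
    from diff_chain_at[OF bounded_linear_imp_has_derivative[OF assms(1)] this]
    show ?thesis by (simp add: o_def)
  qed
  then show ?case
    by (rule times_diff_on_SucI[OF assms(2)]) (use Suc in auto)
qed

section \<open>Closure properties of smooth functions\<close>

lemma smooth_on_cong: "open S \<Longrightarrow> smooth_on S f \<Longrightarrow> (\<And>x. x \<in> S \<Longrightarrow> f x = g x) \<Longrightarrow> smooth_on S g"
  unfolding smooth_on_def using times_diff_on_cong by blast

lemma smooth_on_const: "smooth_on S (\<lambda>x. c)"
  by (simp add: smooth_on_def times_diff_on_const)

lemma smooth_on_add:
  "open S \<Longrightarrow> smooth_on S f \<Longrightarrow> smooth_on S g \<Longrightarrow> smooth_on S (\<lambda>x. f x + g x)"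
  by (simp add: smooth_on_def times_diff_on_add)

lemma smooth_on_scaleR:
  "open S \<Longrightarrow> smooth_on S f \<Longrightarrow> smooth_on S g \<Longrightarrow> smooth_on S (\<lambda>x. f x *\<^sub>R g x)"
  by (simp add: smooth_on_def times_diff_on_bilinear[OF bounded_bilinear_scaleR])

lemma smooth_on_mult:
  fixes f g :: "'a::real_normed_vector \<Rightarrow> real"
  shows "open S \<Longrightarrow> smooth_on S f \<Longrightarrow> smooth_on S g \<Longrightarrow> smooth_on S (\<lambda>x. f x * g x)"
  by (simp add: smooth_on_def times_diff_on_bilinear[OF bounded_bilinear_mult])

lemma smooth_on_inner:
  "open S \<Longrightarrow> smooth_on S f \<Longrightarrow> smooth_on S g \<Longrightarrow> smooth_on S (\<lambda>x. f x \<bullet> g x)"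
  by (simp add: smooth_on_def times_diff_on_bilinear[OF bounded_bilinear_inner])

lemma smooth_on_diff:
  assumes "open S" "smooth_on S f" "smooth_on S g"
  shows "smooth_on S (\<lambda>x. f x - g x)"
  using smooth_on_add[OF assms(1,2) smooth_on_scaleR[OF assms(1) smooth_on_const[of S "-1"] assms(3)]]
  by simp

lemma smooth_on_sum:
  "open S \<Longrightarrow> (\<And>i. i \<in> I \<Longrightarrow> smooth_on S (f i)) \<Longrightarrow> smooth_on S (\<lambda>x. \<Sum>i\<in>I. f i x)"
  by (induction I rule: infinite_finite_induct) (auto intro: smooth_on_const smooth_on_add)

lemma smooth_on_powr:
  fixes f :: "'a::real_normed_vector \<Rightarrow> real"
  shows "open S \<Longrightarrow> smooth_on S f \<Longrightarrow> (\<And>x. x \<in> S \<Longrightarrow> 0 < f x) \<Longrightarrow> smooth_on S (\<lambda>x. f x powr a)"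
  by (simp add: smooth_on_def times_diff_on_powr)

lemma smooth_on_compose_linear:
  "bounded_linear L \<Longrightarrow> open T \<Longrightarrow> L ` T \<subseteq> S \<Longrightarrow> smooth_on S f \<Longrightarrow> smooth_on T (\<lambda>x. f (L x))"
  unfolding smooth_on_def using times_diff_on_compose_linear by blast

lemma smooth_on_differentiable: "smooth_on S f \<Longrightarrow> x \<in> S \<Longrightarrow> f differentiable (at x)"
  unfolding smooth_on_def using times_diff_on.simps(2) by blast

lemma smooth_on_has_derivative: "smooth_on S f \<Longrightarrow> x \<in> S \<Longrightarrow> (f has_derivative fd f x) (at x)"
  by (simp add: smooth_on_differentiable fd_works)

lemma smooth_on_fd: "smooth_on S f \<Longrightarrow> smooth_on S (\<lambda>x. fd f x v)"
  unfolding smooth_on_def using times_diff_on.simps(2) by blast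

lemma smooth_on_continuous_on: "smooth_on S f \<Longrightarrow> continuous_on S f"
  unfolding smooth_on_def using times_diff_on.simps(1) by blast

section \<open>Symmetry of second derivatives\<close>

text \<open>The mean value theorem is applied twice, along \<open>u\<close> to a difference in
  direction \<open>v\<close>, then along \<open>v\<close>. The second difference is symmetric in
  \<open>u\<close> and \<open>v\<close>, so it computes both mixed derivatives.\<close>

lemma second_difference_mean_value:
  fixes F :: "'a::real_normed_vector \<Rightarrow> real"
  assumes F: "smooth_on S F" and s: "0 < s"
    and S: "\<And>a b. 0 \<le> a \<Longrightarrow> a \<le> s \<Longrightarrow> 0 \<le> b \<Longrightarrow> b \<le> s \<Longrightarrow> x + a *\<^sub>R u + b *\<^sub>R v \<in> S"
  obtains a b where "0 < a" "a < s" "0 < b" "b < s"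
    "F (x + s *\<^sub>R u + s *\<^sub>R v) - F (x + s *\<^sub>R u) - F (x + s *\<^sub>R v) + F x =
     s * (s * fd (\<lambda>y. fd F y u) (x + a *\<^sub>R u + b *\<^sub>R v) v)"
proof -
  let ?\<phi> = "\<lambda>r. F (x + r *\<^sub>R u + s *\<^sub>R v) - F (x + r *\<^sub>R u)"
  have *: "((\<lambda>r. H (z + r *\<^sub>R w)) has_real_derivative fd H (z + r *\<^sub>R w) w) (at r)"
    if "smooth_on S H" "z + r *\<^sub>R w \<in> S" for H :: "'a \<Rightarrow> real" and z w r
  proof -
    have "((\<lambda>r. z + r *\<^sub>R w) has_derivative (\<lambda>t. t *\<^sub>R w)) (at r)"
      by (auto intro!: derivative_eq_intros)
    from diff_chain_at[OF this smooth_on_has_derivative[OF that]]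
    have "((\<lambda>r. H (z + r *\<^sub>R w)) has_derivative (\<lambda>t. fd H (z + r *\<^sub>R w) (t *\<^sub>R w))) (at r)"
      by (simp add: o_def)
    moreover have "fd H (z + r *\<^sub>R w) (t *\<^sub>R w) = fd H (z + r *\<^sub>R w) w * t" for t
      using linear_frechet_derivative[OF smooth_on_differentiable[OF that]]
      by (simp add: linear_cmul)
    ultimately show ?thesis by (simp add: has_field_derivative_def)
  qed
  have "(?\<phi> has_real_derivative fd F (x + r *\<^sub>R u + s *\<^sub>R v) u - fd F (x + r *\<^sub>R u) u) (at r)"
    if "0 \<le> r" "r \<le> s" for r
    using *[OF F, of "x + s *\<^sub>R v" r u] *[OF F, of x r u] S[of r s] S[of r 0] that s
    by (intro DERIV_diff) (auto simp: algebra_simps)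
  from MVT2[OF s this] obtain a where a: "0 < a" "a < s"
    "?\<phi> s - ?\<phi> 0 = s * (fd F (x + a *\<^sub>R u + s *\<^sub>R v) u - fd F (x + a *\<^sub>R u) u)" by auto
  have "((\<lambda>r. fd F (x + a *\<^sub>R u + r *\<^sub>R v) u) has_real_derivative
      fd (\<lambda>y. fd F y u) (x + a *\<^sub>R u + r *\<^sub>R v) v) (at r)" if "0 \<le> r" "r \<le> s" for r
    by (rule *[OF smooth_on_fd[OF F]]) (use S[of a r] a that in auto)
  from MVT2[OF s this] obtain b where "0 < b" "b < s"
    "fd F (x + a *\<^sub>R u + s *\<^sub>R v) u - fd F (x + a *\<^sub>R u + 0 *\<^sub>R v) u =
       s * fd (\<lambda>y. fd F y u) (x + a *\<^sub>R u + b *\<^sub>R v) v" by auto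
  with a show ?thesis by (intro that[of a b]) auto
qed

text \<open>The same second difference divided by \<open>s * s\<close> is a value of
  \<open>P\<close> and a value of \<open>Q\<close> at points close to \<open>x\<close>. By
  continuity both values are within half the supposed gap of \<open>P x\<close> and
  \<open>Q x\<close>.\<close>

lemma smooth_on_fd_commute_real:
  fixes F :: "'a::real_normed_vector \<Rightarrow> real"
  assumes S: "open S" "x \<in> S" and F: "smooth_on S F"
  shows "fd (\<lambda>y. fd F y u) x v = fd (\<lambda>y. fd F y v) x u"
proof (rule ccontr)
  define P where "P = (\<lambda>y. fd (\<lambda>y. fd F y u) y v)"
  define Q where "Q = (\<lambda>y. fd (\<lambda>y. fd F y v) y u)"
  assume "fd (\<lambda>y. fd F y u) x v \<noteq> fd (\<lambda>y. fd F y v) x u"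
  then have e: "0 < \<bar>P x - Q x\<bar> / 2" by (simp add: P_def Q_def)
  have cont: "isCont P x" "isCont Q x"
    using S continuous_on_eq_continuous_at[OF S(1)]
      smooth_on_continuous_on[OF smooth_on_fd[OF smooth_on_fd[OF F]]]
    unfolding P_def Q_def by blast+
  obtain d1 where d1: "0 < d1" "\<And>y. dist y x < d1 \<Longrightarrow> dist (P y) (P x) < \<bar>P x - Q x\<bar> / 2"
    using cont(1) e unfolding continuous_at_eps_delta by blast
  obtain d2 where d2: "0 < d2" "\<And>y. dist y x < d2 \<Longrightarrow> dist (Q y) (Q x) < \<bar>P x - Q x\<bar> / 2"
    using cont(2) e unfolding continuous_at_eps_delta by blast
  obtain d3 where d3: "0 < d3" "\<And>y. dist y x < d3 \<Longrightarrow> y \<in> S"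
    using S by (metis open_dist)
  define d where "d = min d1 (min d2 d3)"
  \<comment> \<open>This side length keeps the whole parallelogram strictly within distance
    \<open>d\<close> of \<open>x\<close>; the summand 1 gives strictness and covers
    \<open>u = v = 0\<close>.\<close>
  define s where "s = d / (norm u + norm v + 1)"
  have dp: "0 < d" using d1 d2 d3 by (simp add: d_def)
  have n: "0 < norm u + norm v + 1"
    by (smt (verit) norm_ge_zero)
  have s: "0 < s" using dp n by (simp add: s_def)
  have small: "dist (x + a *\<^sub>R u + b *\<^sub>R v) x < d" if "0 \<le> a" "a \<le> s" "0 \<le> b" "b \<le> s" for a b
  proof -
    have "dist (x + a *\<^sub>R u + b *\<^sub>R v) x = norm (a *\<^sub>R u + b *\<^sub>R v)"
      by (simp add: dist_norm add.assoc)
    also have "\<dots> \<le> a * norm u + b * norm v"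
      using norm_triangle_ineq[of "a *\<^sub>R u" "b *\<^sub>R v"] that by simp
    also have "\<dots> \<le> s * norm u + s * norm v"
      using that by (intro add_mono mult_right_mono) auto
    also have "\<dots> < s * (norm u + norm v + 1)" using s by (simp add: algebra_simps)
    also have "\<dots> = d" using n by (simp add: s_def)
    finally show ?thesis .
  qed
  have inS: "x + a *\<^sub>R u + b *\<^sub>R v \<in> S" if "0 \<le> a" "a \<le> s" "0 \<le> b" "b \<le> s" for a b
    using small[OF that] d3(2) by (simp add: d_def)
  obtain a b where ab: "0 < a" "a < s" "0 < b" "b < s"
    "F (x + s *\<^sub>R u + s *\<^sub>R v) - F (x + s *\<^sub>R u) - F (x + s *\<^sub>R v) + F x =
     s * (s * P (x + a *\<^sub>R u + b *\<^sub>R v))"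
    using second_difference_mean_value[OF F s inS] unfolding P_def by blast
  have inS': "x + a *\<^sub>R v + b *\<^sub>R u \<in> S" if "0 \<le> a" "a \<le> s" "0 \<le> b" "b \<le> s" for a b
    using inS[of b a] that by (simp add: algebra_simps)
  obtain a' b' where ab': "0 < a'" "a' < s" "0 < b'" "b' < s"
    "F (x + s *\<^sub>R v + s *\<^sub>R u) - F (x + s *\<^sub>R v) - F (x + s *\<^sub>R u) + F x =
     s * (s * Q (x + a' *\<^sub>R v + b' *\<^sub>R u))"
    using second_difference_mean_value[OF F s inS'] unfolding Q_def by blast
  have eq: "P (x + a *\<^sub>R u + b *\<^sub>R v) = Q (x + b' *\<^sub>R u + a' *\<^sub>R v)"
    using ab(5) ab'(5) s by (simp add: algebra_simps)
  have "dist (P (x + a *\<^sub>R u + b *\<^sub>R v)) (P x) < \<bar>P x - Q x\<bar> / 2"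
    by (rule d1(2)) (use small[of a b] ab in \<open>simp add: d_def\<close>)
  moreover have "dist (Q (x + b' *\<^sub>R u + a' *\<^sub>R v)) (Q x) < \<bar>P x - Q x\<bar> / 2"
    by (rule d2(2)) (use small[of b' a'] ab' in \<open>simp add: d_def\<close>)
  ultimately have "dist (P x) (Q x) < \<bar>P x - Q x\<bar>"
    unfolding eq by (rule dist_triangle_half_r)
  then show False by (simp add: dist_real_def)
qed

text \<open>Reduction to components. The auxiliary fact \<open>inner\<close> is needed on all of
  \<open>S\<close>, because it is used under a second derivative.\<close>

lemma smooth_on_fd_commute:
  fixes F :: "'a::real_normed_vector \<Rightarrow> 'b::euclidean_space"
  assumes S: "open S" "x \<in> S" and F: "smooth_on S F"
  shows "fd (\<lambda>y. fd F y u) x v = fd (\<lambda>y. fd F y v) x u"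
proof (rule euclidean_eqI)
  fix b :: 'b
  have inner: "fd (\<lambda>y. H y \<bullet> b) y w = fd H y w \<bullet> b"
    if "smooth_on S H" "y \<in> S" for H :: "'a \<Rightarrow> 'b" and y w
    by (simp add: fd_eqI[OF has_derivative_inner_left[OF smooth_on_has_derivative[OF that]]])
  have Fb: "smooth_on S (\<lambda>y. F y \<bullet> b)"
    by (intro smooth_on_inner S F smooth_on_const)
  have "fd (\<lambda>y. fd F y u) x v \<bullet> b = fd (\<lambda>y. fd (\<lambda>y. F y \<bullet> b) y u) x v" for u v
  proof -
    have "fd (\<lambda>y. fd F y u) x v \<bullet> b = fd (\<lambda>y. fd F y u \<bullet> b) x v"
      by (simp add: inner[OF smooth_on_fd[OF F] S(2)])
    also have "\<dots> = fd (\<lambda>y. fd (\<lambda>y. F y \<bullet> b) y u) x v"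
      by (subst frechet_derivative_transform_within_open[of _ x S "\<lambda>y. fd (\<lambda>y. F y \<bullet> b) y u"])
        (use S smooth_on_differentiable[OF smooth_on_inner[OF S(1) smooth_on_fd[OF F] smooth_on_const] S(2)]
          in \<open>auto simp: inner[OF F]\<close>)
    finally show ?thesis .
  qed
  then show "fd (\<lambda>y. fd F y u) x v \<bullet> b = fd (\<lambda>y. fd F y v) x u \<bullet> b"
    using smooth_on_fd_commute_real[OF S Fb] by simp
qed

section \<open>Linear maps depending on a point\<close>

text \<open>Product rule for a linear map applied to a moving vector. Expanding the vector in
  \<open>Basis\<close> reduces it to scalar products, so differentiability of \<open>L\<close> is
  only required on fixed vectors. It differentiates expressions such as
  \<open>fd \<Psi> y (\<xi> y)\<close> and Christoffel terms.\<close>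

lemma has_derivative_linear_family:
  fixes L :: "'a::real_normed_vector \<Rightarrow> 'b::euclidean_space \<Rightarrow> 'c::real_normed_vector"
  assumes "open S" "x \<in> S" and lin: "\<And>y. y \<in> S \<Longrightarrow> linear (L y)"
    and L: "\<And>w. (\<lambda>y. L y w) differentiable (at x)" and \<xi>: "(\<xi> has_derivative \<xi>') (at x)"
  shows "((\<lambda>y. L y (\<xi> y)) has_derivative (\<lambda>t. L x (\<xi>' t) + fd (\<lambda>y. L y (\<xi> x)) x t)) (at x)"
proof -
  have expand: "L y w = (\<Sum>b\<in>Basis. (w \<bullet> b) *\<^sub>R L y b)" if "y \<in> S" for y w
  proof -
    have "L y w = L y (\<Sum>b\<in>Basis. (w \<bullet> b) *\<^sub>R b)" by (simp add: euclidean_representation)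
    also have "\<dots> = (\<Sum>b\<in>Basis. (w \<bullet> b) *\<^sub>R L y b)"
      by (simp add: linear_sum[OF lin[OF that]] linear_cmul[OF lin[OF that]])
    finally show ?thesis .
  qed
  have 1: "((\<lambda>y. \<Sum>b\<in>Basis. (\<eta> y \<bullet> b) *\<^sub>R L y b) has_derivative
      (\<lambda>t. \<Sum>b\<in>Basis. (\<eta> x \<bullet> b) *\<^sub>R fd (\<lambda>y. L y b) x t + (\<eta>' t \<bullet> b) *\<^sub>R L x b)) (at x)"
    if "(\<eta> has_derivative \<eta>') (at x)" for \<eta> \<eta>'
    by (intro has_derivative_sum has_derivative_scaleR has_derivative_inner_left that fd_works L)
  have 2: "((\<lambda>y. L y (\<eta> y)) has_derivative
      (\<lambda>t. \<Sum>b\<in>Basis. (\<eta> x \<bullet> b) *\<^sub>R fd (\<lambda>y. L y b) x t + (\<eta>' t \<bullet> b) *\<^sub>R L x b)) (at x)"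
    if "(\<eta> has_derivative \<eta>') (at x)" for \<eta> \<eta>'
    by (rule has_derivative_transform_within_open[OF 1[OF that] assms(1,2)]) (rule expand[symmetric])
  \<comment> \<open>A constant \<open>\<eta>\<close> in the same expansion identifies the first half
    of the sum as the derivative with the vector frozen.\<close>
  have "fd (\<lambda>y. L y w) x = (\<lambda>t. \<Sum>b\<in>Basis. (w \<bullet> b) *\<^sub>R fd (\<lambda>y. L y b) x t)" for w
    by (rule fd_eqI) (use 2[OF has_derivative_const[of w]] in simp)
  from this[of "\<xi> x"]
  have "(\<lambda>t. \<Sum>b\<in>Basis. (\<xi> x \<bullet> b) *\<^sub>R fd (\<lambda>y. L y b) x t + (\<xi>' t \<bullet> b) *\<^sub>R L x b) =
      (\<lambda>t. L x (\<xi>' t) + fd (\<lambda>y. L y (\<xi> x)) x t)"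
    by (simp only: sum.distrib add.commute expand[OF assms(2), symmetric])
  with 2[OF \<xi>] show ?thesis by (simp only:)
qed

lemma smooth_on_linear_family:
  fixes L :: "'a::real_normed_vector \<Rightarrow> 'b::euclidean_space \<Rightarrow> 'c::real_normed_vector"
  assumes S: "open S" and lin: "\<And>y. y \<in> S \<Longrightarrow> linear (L y)"
    and L: "\<And>w. smooth_on S (\<lambda>y. L y w)" and \<xi>: "smooth_on S \<xi>"
  shows "smooth_on S (\<lambda>y. L y (\<xi> y))"
proof (rule smooth_on_cong[OF S])
  show "smooth_on S (\<lambda>y. \<Sum>b\<in>Basis. (\<xi> y \<bullet> b) *\<^sub>R L y b)"
    by (intro smooth_on_sum smooth_on_scaleR smooth_on_inner smooth_on_const S L \<xi>)
  show "(\<Sum>b\<in>Basis. (\<xi> y \<bullet> b) *\<^sub>R L y b) = L y (\<xi> y)" if "y \<in> S" for y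
  proof -
    have "L y (\<xi> y) = L y (\<Sum>b\<in>Basis. (\<xi> y \<bullet> b) *\<^sub>R b)" by (simp add: euclidean_representation)
    also have "\<dots> = (\<Sum>b\<in>Basis. (\<xi> y \<bullet> b) *\<^sub>R L y b)"
      by (simp add: linear_sum[OF lin[OF that]] linear_cmul[OF lin[OF that]])
    finally show ?thesis by simp
  qed
qed

lemma linear_fd_family:
  assumes S: "open S" "x \<in> S" and lin: "\<And>y. y \<in> S \<Longrightarrow> linear (L y)"
    and L: "\<And>w. (\<lambda>y. L y w) differentiable (at x)"
  shows "linear (\<lambda>w. fd (\<lambda>y. L y w) x t)"
proof (rule linearI)
  fix v w c
  have "((\<lambda>y. L y (v + w)) has_derivative (\<lambda>t. fd (\<lambda>y. L y v) x t + fd (\<lambda>y. L y w) x t)) (at x)"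
    by (rule has_derivative_transform_within_open[OF has_derivative_add[OF fd_works[OF L[of v]] fd_works[OF L[of w]]] S])
      (simp add: linear_add[OF lin])
  from fd_eqI[OF this]
  show "fd (\<lambda>y. L y (v + w)) x t = fd (\<lambda>y. L y v) x t + fd (\<lambda>y. L y w) x t" by simp
  have "((\<lambda>y. L y (c *\<^sub>R w)) has_derivative (\<lambda>t. c *\<^sub>R fd (\<lambda>y. L y w) x t)) (at x)"
    by (rule has_derivative_transform_within_open[OF has_derivative_scaleR_right[OF fd_works[OF L[of w]]] S])
      (simp add: linear_cmul[OF lin])
  from fd_eqI[OF this]
  show "fd (\<lambda>y. L y (c *\<^sub>R w)) x t = c *\<^sub>R fd (\<lambda>y. L y w) x t" by simp
qed

section \<open>Orthonormal frames and the Levi-Civita connection\<close>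

text \<open>Orthonormal vectors are independent, and there are as many as the dimension, so they
  span. The remainder of the expansion is orthogonal to all of them, hence to itself.\<close>

lemma orthonormal_expansion:
  fixes g :: "'a::euclidean_space \<Rightarrow> 'a \<Rightarrow> real"
  assumes g: "bilinear g" and pos: "\<And>v. v \<noteq> 0 \<Longrightarrow> 0 < g v v"
    and e: "\<And>k l. k < DIM('a) \<Longrightarrow> l < DIM('a) \<Longrightarrow> g (e k) (e l) = (if k = l then 1 else 0)"
  shows "v = (\<Sum>k<DIM('a). g v (e k) *\<^sub>R e k)"
proof -
  let ?I = "{..<DIM('a)}"
  have lin: "linear (\<lambda>z. g z w)" "linear (\<lambda>z. g w z)" for w
    using g by (auto simp: bilinear_def)
  have inj: "inj_on e ?I"
    by (rule inj_onI) (metis e lessThan_iff zero_neq_one)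
  have "independent (e ` ?I)"
    unfolding dependent_def
  proof safe
    fix k assume k: "k < DIM('a)" and "e k \<in> span (e ` ?I - {e k})"
    \<comment> \<open>This subspace contains every other frame vector but not \<open>e k\<close>, as
      \<open>g (e k) (e k) = 1\<close>.\<close>
    have "subspace {z. g z (e k) = 0}"
      using linear_subspace_kernel[OF lin(1)] by simp
    moreover have "e ` ?I - {e k} \<subseteq> {z. g z (e k) = 0}" using e k by auto
    ultimately have "e k \<in> {z. g z (e k) = 0}"
      using \<open>e k \<in> span _\<close> span_minimal by blast
    then show False using e[OF k k] by simp
  qed
  then have span: "UNIV \<subseteq> span (e ` ?I)"
    by (intro card_ge_dim_independent) (auto simp: card_image[OF inj])
  define r where "r = v - (\<Sum>k<DIM('a). g v (e k) *\<^sub>R e k)"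
  have "g r (e l) = 0" if "l < DIM('a)" for l
  proof -
    have "g r (e l) = g v (e l) - (\<Sum>k<DIM('a). g v (e k) * g (e k) (e l))"
      unfolding r_def by (simp add: linear_diff[OF lin(1)] linear_sum[OF lin(1)] linear_cmul[OF lin(1)])
    also have "(\<Sum>k<DIM('a). g v (e k) * g (e k) (e l)) = (\<Sum>k<DIM('a). if k = l then g v (e k) else 0)"
      by (rule sum.cong) (use e that in auto)
    finally show ?thesis using that by simp
  qed
  then have "e ` ?I \<subseteq> {z. g r z = 0}" by auto
  moreover have "subspace {z. g r z = 0}" using linear_subspace_kernel[OF lin(2)] by simp
  ultimately have "g r r = 0" using span span_minimal by blast
  then have "r = 0" using pos[of r] by force
  then show ?thesis by (simp add: r_def)
qed

text \<open>The Koszul formula on coordinate-constant fields, whose brackets vanish: the Christoffel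
  symbols of the first kind.\<close>

definition koszul :: "'a::euclidean_space metric \<Rightarrow> 'a \<Rightarrow> 'a \<Rightarrow> 'a \<Rightarrow> 'a \<Rightarrow> real" where
  "koszul G x u v w =
     (fd (\<lambda>y. G y v w) x u + fd (\<lambda>y. G y u w) x v - fd (\<lambda>y. G y u v) x w) / 2"

section \<open>Smooth orthonormal frames on a coordinate domain\<close>

locale metric_chart =
  fixes U :: "'a::euclidean_space set" and G :: "'a metric"
  assumes open_U: "open U" and metric: "local_metric U G"
begin

lemma bilin: "x \<in> U \<Longrightarrow> bilinear (G x)"
  and sym: "x \<in> U \<Longrightarrow> G x v w = G x w v"
  and pos: "x \<in> U \<Longrightarrow> v \<noteq> 0 \<Longrightarrow> 0 < G x v v"
  and smooth: "smooth_on U (\<lambda>x. G x v w)"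
  using metric unfolding local_metric_def by blast+

lemma lin_left: "x \<in> U \<Longrightarrow> linear (\<lambda>v. G x v w)"
  and lin_right: "x \<in> U \<Longrightarrow> linear (G x v)"
  using bilin by (auto simp: bilinear_def)

lemma eq_if_inner_eq:
  assumes "x \<in> U" "\<And>w. G x v w = G x v' w"
  shows "v = v'"
proof (rule ccontr)
  assume "v \<noteq> v'"
  then have "0 < G x (v - v') (v - v')" using pos assms(1) by simp
  then show False using assms by (simp add: linear_diff[OF lin_left])
qed

lemma smooth_on_metric:
  assumes "smooth_on U a" "smooth_on U b"
  shows "smooth_on U (\<lambda>x. G x (a x) (b x))"
proof (rule smooth_on_linear_family[OF open_U _ _ assms(2)])
  show "smooth_on U (\<lambda>y. G y (a y) w)" for w
    by (rule smooth_on_linear_family[OF open_U _ _ assms(1), where L = "\<lambda>y v. G y v w"])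
      (auto intro: lin_left smooth)
qed (rule lin_right)

text \<open>Orthonormalization of constant vectors, carried out at all points at once. The span
  condition is carried along because it keeps the next residual nonzero everywhere, so that
  normalizing it is smooth.\<close>

lemma gram_schmidt:
  fixes b :: "nat \<Rightarrow> 'a"
  assumes b: "\<And>k. k < N \<Longrightarrow> b k \<notin> span (b ` {..<k})" and "n \<le> N"
  shows "\<exists>e. (\<forall>k<n. smooth_on U (e k)) \<and>
    (\<forall>x\<in>U. \<forall>k<n. e k x \<in> span (b ` {..k})) \<and>
    (\<forall>x\<in>U. \<forall>k<n. \<forall>l<n. G x (e k x) (e l x) = (if k = l then 1 else 0))"
  using assms(2)
proof (induction n)
  case (Suc n)
  then obtain e where sm: "\<And>k. k < n \<Longrightarrow> smooth_on U (e k)"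
    and sp: "\<And>x k. x \<in> U \<Longrightarrow> k < n \<Longrightarrow> e k x \<in> span (b ` {..k})"
    and on: "\<And>x k l. x \<in> U \<Longrightarrow> k < n \<Longrightarrow> l < n \<Longrightarrow> G x (e k x) (e l x) = (if k = l then 1 else 0)"
    by force
  \<comment> \<open>\<open>w\<close> is the part of \<open>b n\<close> orthogonal to the frame so
    far, \<open>q\<close> its squared length; the power \<open>-1/2\<close> of \<open>q\<close>
    normalizes it and is smooth because \<open>q\<close> is positive.\<close>
  define w where "w = (\<lambda>x. b n - (\<Sum>j<n. G x (b n) (e j x) *\<^sub>R e j x))"
  define q where "q = (\<lambda>x. G x (w x) (w x))"
  define e' where "e' = e(n := \<lambda>x. q x powr (-1/2) *\<^sub>R w x)"
  have sm_w: "smooth_on U w"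
    unfolding w_def
    by (intro smooth_on_diff smooth_on_const smooth_on_sum smooth_on_scaleR smooth_on_metric open_U)
      (auto intro: sm)
  have sum_span: "(\<Sum>j<n. G x (b n) (e j x) *\<^sub>R e j x) \<in> span (b ` {..<n})" if "x \<in> U" for x
    by (intro span_sum span_mul subsetD[OF span_mono sp[OF that]]) auto
  have w0: "w x \<noteq> 0" if "x \<in> U" for x
    using sum_span[OF that] b[of n] Suc.prems by (auto simp: w_def)
  have q: "0 < q x" if "x \<in> U" for x
    using pos[OF that w0[OF that]] by (simp add: q_def)
  have we: "G x (w x) (e l x) = 0" if "x \<in> U" "l < n" for x l
  proof -
    have "G x (w x) (e l x) = G x (b n) (e l x) - (\<Sum>j<n. G x (b n) (e j x) * G x (e j x) (e l x))"
      unfolding w_def by (simp add: linear_diff[OF lin_left[OF that(1)]] linear_sum[OF lin_left[OF that(1)]] linear_cmul[OF lin_left[OF that(1)]])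
    also have "(\<Sum>j<n. G x (b n) (e j x) * G x (e j x) (e l x)) =
        (\<Sum>j<n. if j = l then G x (b n) (e j x) else 0)"
      by (rule sum.cong) (use on that in auto)
    finally show ?thesis using that by simp
  qed
  show ?case
  proof (intro exI[of _ e'] conjI ballI allI impI)
    show "smooth_on U (e' k)" if "k < Suc n" for k
      using that sm smooth_on_scaleR[OF open_U smooth_on_powr[OF open_U smooth_on_metric[OF sm_w sm_w]] sm_w] q
      by (auto simp: e'_def q_def)
    show "e' k x \<in> span (b ` {..k})" if "x \<in> U" "k < Suc n" for x k
    proof (cases "k = n")
      case True
      have "w x \<in> span (b ` {..n})"
        unfolding w_def
        by (rule span_diff[OF span_base subsetD[OF span_mono sum_span[OF that(1)]]]) auto
      then show ?thesis using True by (simp add: e'_def span_mul)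
    qed (use sp that in \<open>auto simp: e'_def\<close>)
    show "G x (e' k x) (e' l x) = (if k = l then 1 else 0)"
      if x: "x \<in> U" and kl: "k < Suc n" "l < Suc n" for x k l
    proof -
      have sc: "G x (a *\<^sub>R u) v = a * G x u v" "G x u (a *\<^sub>R v) = a * G x u v" for a u v
        using linear_cmul[OF lin_left[OF x]] linear_cmul[OF lin_right[OF x]] by simp_all
      \<comment> \<open>The squared length of the new vector is \<open>q x\<close> to the exponent
        \<open>- 1/2 - 1/2 + 1 = 0\<close>.\<close>
      have "q x powr (- 1/2) * (q x powr (- 1/2) * q x) = q x powr (- 1/2) * q x powr (- 1/2) * q x powr 1"
        using q[OF x] by simp
      also have "\<dots> = 1" using q[OF x] by (simp only: powr_add[symmetric]) simp
      finally have "q x powr (- 1/2) * (q x powr (- 1/2) * q x) = 1" .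
      then have "G x (e' n x) (e' n x) = 1" unfolding e'_def by (simp add: sc q_def)
      moreover have "G x (e' n x) (e' l x) = 0" "G x (e' l x) (e' n x) = 0" if "l < n" for l
        using we[OF x that] sym[OF x, of "w x"] that by (simp_all add: e'_def sc)
      ultimately show ?thesis using kl on[OF x] by (auto simp: less_Suc_eq e'_def)
    qed
  qed
qed simp

lemma orthonormal_frame_exists: "\<exists>e. orthonormal_frame G U e"
proof -
  obtain b where b: "bij_betw b {0..<DIM('a)} (Basis :: 'a set)"
    using ex_bij_betw_nat_finite[OF finite_Basis] by blast
  have "b k \<notin> span (b ` {..<k})" if "k < DIM('a)" for k
  proof
    assume "b k \<in> span (b ` {..<k})"
    moreover have "b ` {..<k} \<subseteq> Basis - {b k}"
    proof safe
      fix j assume "j < k"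
      then show "b j \<in> Basis" using b that by (auto simp: bij_betw_def)
    next
      fix j assume "j < k" "b j = b k"
      then show False
        using inj_onD[OF bij_betw_imp_inj_on[OF b], of j k] that by simp
    qed
    ultimately have "b k \<in> span (Basis - {b k})" using span_mono by blast
    moreover have "b k \<in> Basis" using b that by (auto simp: bij_betw_def)
    ultimately show False using independent_Basis unfolding dependent_def by blast
  qed
  from gram_schmidt[OF this order_refl] show ?thesis
    unfolding orthonormal_frame_def by blast
qed

section \<open>Existence, uniqueness and smoothness of the Levi-Civita connection\<close>

lemma fd_metric_sym: "x \<in> U \<Longrightarrow> fd (\<lambda>y. G y v w) x = fd (\<lambda>y. G y w v) x"
  by (rule frechet_derivative_transform_within_open[OF smooth_on_differentiable[OF smooth] open_U])
    (auto intro: sym)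

lemma fd_metric_linear:
  assumes x: "x \<in> U"
  shows "linear (\<lambda>w. fd (\<lambda>y. G y v w) x t)" "linear (\<lambda>w. fd (\<lambda>y. G y w v) x t)"
    "linear (fd (\<lambda>y. G y v w) x)"
  using linear_fd_family[OF open_U x lin_right smooth_on_differentiable[OF smooth x]]
    linear_fd_family[OF open_U x lin_left smooth_on_differentiable[OF smooth x]]
    linear_frechet_derivative[OF smooth_on_differentiable[OF smooth x]] by auto

lemma koszul_linear:
  assumes x: "x \<in> U"
  shows "linear (koszul G x u v)" "linear (\<lambda>u. koszul G x u v w)" "linear (\<lambda>v. koszul G x u v w)"
  unfolding koszul_def
  by (intro linearI; simp add: linear_add[OF fd_metric_linear(1)[OF x]]
      linear_add[OF fd_metric_linear(2)[OF x]] linear_add[OF fd_metric_linear(3)[OF x]]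
      linear_cmul[OF fd_metric_linear(1)[OF x]] linear_cmul[OF fd_metric_linear(2)[OF x]]
      linear_cmul[OF fd_metric_linear(3)[OF x]] field_simps)+

lemma koszul_sym: "x \<in> U \<Longrightarrow> koszul G x u v w = koszul G x v u w"
  by (simp add: koszul_def fd_metric_sym[of x u v])

lemma koszul_metric: "x \<in> U \<Longrightarrow> koszul G x u v w + koszul G x u w v = fd (\<lambda>y. G y v w) x u"
  by (simp add: koszul_def fd_metric_sym[of x w v] field_simps)

lemma smooth_on_koszul: "smooth_on U (\<lambda>x. koszul G x u v w)"
proof -
  have "smooth_on U (\<lambda>x. (1/2) * (fd (\<lambda>y. G y v w) x u + fd (\<lambda>y. G y u w) x v - fd (\<lambda>y. G y u v) x w))"
    by (intro smooth_on_mult smooth_on_diff smooth_on_add smooth_on_const smooth_on_fd open_U smooth)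
  then show ?thesis by (simp add: koszul_def)
qed

text \<open>The predicate under the definite description in \<open>christoffel\<close>, named so
  that existence and uniqueness can be treated separately.\<close>

definition is_connection :: "'a \<Rightarrow> ('a \<Rightarrow> 'a \<Rightarrow> 'a) \<Rightarrow> bool" where
  "is_connection x \<Gamma> \<longleftrightarrow> bilinear \<Gamma> \<and> (\<forall>u v. \<Gamma> u v = \<Gamma> v u) \<and>
     (\<forall>u v w. fd (\<lambda>y. G y v w) x u = G x (\<Gamma> u v) w + G x v (\<Gamma> u w))"

text \<open>Metric compatibility turns the three derivatives into six terms, four of which cancel in
  pairs by symmetry of \<open>\<Gamma>\<close> and of the metric. This is the uniqueness of the
  connection.\<close>

lemma koszul_formula:
  assumes x: "x \<in> U" and "is_connection x \<Gamma>"
  shows "G x (\<Gamma> u v) w = koszul G x u v w"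
proof -
  have s: "\<Gamma> u v = \<Gamma> v u" for u v using assms by (simp add: is_connection_def)
  have m: "fd (\<lambda>y. G y v w) x u = G x (\<Gamma> u v) w + G x v (\<Gamma> u w)" for u v w
    using assms by (simp add: is_connection_def)
  show ?thesis
    unfolding koszul_def m
    by (simp add: s[of w u] s[of w v] s[of v u] sym[OF x, of v] sym[OF x, of u])
qed

text \<open>A smooth frame gives the Christoffel symbols without inverting the metric, and shows at
  once that they are smooth.\<close>

lemma is_connection_frame:
  assumes x: "x \<in> U" and e: "orthonormal_frame G U e"
  shows "is_connection x (\<lambda>u v. \<Sum>k<DIM('a). koszul G x u v (e k x) *\<^sub>R e k x)"
    (is "is_connection x ?\<Gamma>")
proof -
  have exp: "w = (\<Sum>k<DIM('a). G x w (e k x) *\<^sub>R e k x)" for w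
    by (rule orthonormal_expansion[OF bilin[OF x] pos[OF x]])
      (use e x in \<open>auto simp: orthonormal_frame_def\<close>)
  have K: "G x (?\<Gamma> u v) w = koszul G x u v w" for u v w
  proof -
    have "G x (?\<Gamma> u v) w = (\<Sum>k<DIM('a). koszul G x u v (e k x) * G x w (e k x))"
      by (simp add: linear_sum[OF lin_left[OF x]] linear_cmul[OF lin_left[OF x]] sym[OF x, of w])
    also have "\<dots> = koszul G x u v (\<Sum>k<DIM('a). G x w (e k x) *\<^sub>R e k x)"
      by (simp add: linear_sum[OF koszul_linear(1)[OF x]] linear_cmul[OF koszul_linear(1)[OF x]] mult.commute)
    also have "\<dots> = koszul G x u v w" using exp[of w] by simp
    finally show ?thesis .
  qed
  have "bilinear ?\<Gamma>"
    unfolding bilinear_def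
    by (intro conjI allI linear_compose_sum linear_compose_scale_right ballI
        linear_compose[OF koszul_linear(2)[OF x] linear_scaleR_left, unfolded o_def]
        linear_compose[OF koszul_linear(3)[OF x] linear_scaleR_left, unfolded o_def])
  moreover have "?\<Gamma> u v = ?\<Gamma> v u" for u v by (simp add: koszul_sym[OF x, of u v])
  moreover have "fd (\<lambda>y. G y v w) x u = G x (?\<Gamma> u v) w + G x v (?\<Gamma> u w)" for u v w
    using K[of u v w] K[of u w v] sym[OF x, of v] koszul_metric[OF x, of u v w] by simp
  ultimately show ?thesis unfolding is_connection_def by blast
qed

lemma christoffel_eqI:
  assumes x: "x \<in> U" and \<Gamma>: "is_connection x \<Gamma>"
  shows "christoffel G x = \<Gamma>"
  unfolding christoffel_def
proof (rule the_equality)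
  show "bilinear \<Gamma> \<and> (\<forall>u v. \<Gamma> u v = \<Gamma> v u) \<and>
     (\<forall>u v w. fd (\<lambda>y. G y v w) x u = G x (\<Gamma> u v) w + G x v (\<Gamma> u w))"
    using \<Gamma> by (simp add: is_connection_def)
  fix \<Gamma>' assume "bilinear \<Gamma>' \<and> (\<forall>u v. \<Gamma>' u v = \<Gamma>' v u) \<and>
     (\<forall>u v w. fd (\<lambda>y. G y v w) x u = G x (\<Gamma>' u v) w + G x v (\<Gamma>' u w))"
  then have \<Gamma>': "is_connection x \<Gamma>'" by (simp add: is_connection_def)
  show "\<Gamma>' = \<Gamma>"
    by (intro ext eq_if_inner_eq[OF x]) (simp add: koszul_formula[OF x \<Gamma>] koszul_formula[OF x \<Gamma>'])
qed

lemma is_connection_christoffel: "x \<in> U \<Longrightarrow> is_connection x (christoffel G x)"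
proof -
  assume x: "x \<in> U"
  obtain e where "orthonormal_frame G U e" using orthonormal_frame_exists by blast
  note \<Gamma> = is_connection_frame[OF x this]
  show ?thesis using christoffel_eqI[OF x \<Gamma>] \<Gamma> by simp
qed

lemma christoffel_bilinear: "x \<in> U \<Longrightarrow> bilinear (christoffel G x)"
  and christoffel_sym: "x \<in> U \<Longrightarrow> christoffel G x u v = christoffel G x v u"
  using is_connection_christoffel unfolding is_connection_def by blast+

lemma christoffel_koszul: "x \<in> U \<Longrightarrow> G x (christoffel G x u v) w = koszul G x u v w"
  by (simp add: is_connection_christoffel koszul_formula)

lemma smooth_on_christoffel: "smooth_on U (\<lambda>x. christoffel G x u v)"
proof -
  obtain e where e: "orthonormal_frame G U e" using orthonormal_frame_exists by blast
  have "smooth_on U (\<lambda>x. koszul G x u v (e k x))" if "k < DIM('a)" for k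
    by (rule smooth_on_linear_family[OF open_U koszul_linear(1) smooth_on_koszul])
      (use e that in \<open>auto simp: orthonormal_frame_def\<close>)
  then have "smooth_on U (\<lambda>x. \<Sum>k<DIM('a). koszul G x u v (e k x) *\<^sub>R e k x)"
    using e by (intro smooth_on_sum smooth_on_scaleR open_U) (auto simp: orthonormal_frame_def)
  then show ?thesis
    by (rule smooth_on_cong[OF open_U]) (simp add: christoffel_eqI[OF _ is_connection_frame[OF _ e]])
qed

lemma curvature_eq:
  assumes x: "x \<in> U"
  shows "curvature G x u v w =
    fd (\<lambda>y. christoffel G y v w) x u + christoffel G x u (christoffel G x v w) -
    (fd (\<lambda>y. christoffel G y u w) x v + christoffel G x v (christoffel G x u w))"
  by (simp add: curvature_def cov_deriv_def dir_deriv_def)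

end

section \<open>The Gauss equation of a totally geodesic immersion\<close>

text \<open>The Gauss formula with vanishing second fundamental form is differentiated along \<open>t\<close> and
  antisymmetrized in \<open>t\<close> and \<open>u\<close>, which removes the third derivatives of \<open>\<Psi>\<close>.\<close>

lemma gauss_equation_totally_geodesic:
  fixes \<Psi> :: "'a::euclidean_space \<Rightarrow> 'b::euclidean_space"
  assumes M: "metric_chart U G" and N: "metric_chart V G'"
    and S: "open S" "x \<in> S" "S \<subseteq> U" and \<Psi>: "smooth_on S \<Psi>" "\<Psi> ` S \<subseteq> V"
    and tg: "\<And>y u v. y \<in> S \<Longrightarrow> second_fundamental_form G G' \<Psi> y u v = 0"
  shows "curvature G' (\<Psi> x) (fd \<Psi> x t) (fd \<Psi> x u) (fd \<Psi> x v) = fd \<Psi> x (curvature G x t u v)"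
proof -
  interpret M: metric_chart U G by fact
  interpret N: metric_chart V G' by fact
  let ?C = "christoffel G" and ?C' = "christoffel G'" and ?d = "fd \<Psi> x"
  define D2 where "D2 = (\<lambda>t v. fd (\<lambda>y. fd \<Psi> y v) x t)"
  define DC' where "DC' = (\<lambda>t u v. fd (\<lambda>z. ?C' z u v) (\<Psi> x) t)"
  have xU: "x \<in> U" and xV: "\<Psi> x \<in> V" using S \<Psi> by auto
  have lin_d: "linear (fd \<Psi> y)" if "y \<in> S" for y
    using linear_frechet_derivative[OF smooth_on_differentiable[OF \<Psi>(1) that]] .
  have lin_C': "linear (?C' z u)" "linear (\<lambda>u. ?C' z u v)" if "z \<in> V" for z u v
    using N.christoffel_bilinear[OF that] by (auto simp: bilinear_def)
  have gauss_formula: "fd (\<lambda>z. fd \<Psi> z v) y u + ?C' (\<Psi> y) (fd \<Psi> y u) (fd \<Psi> y v) = fd \<Psi> y (?C y u v)"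
    if "y \<in> S" for y u v
    using tg[OF that, of u v]
    by (simp add: second_fundamental_form_def dir_deriv_def cov_deriv_def Let_def)
  \<comment> \<open>The Gauss formula at \<open>x\<close>, solved for the second derivative of
    \<open>\<Psi>\<close>, so that it can be eliminated at the end.\<close>
  have D2: "D2 t v = ?d (?C x t v) - ?C' (\<Psi> x) (?d t) (?d v)" for t v
    using gauss_formula[OF S(2), of v t] by (simp add: D2_def algebra_simps)
  have deriv_d: "((\<lambda>y. fd \<Psi> y v) has_derivative (\<lambda>t. D2 t v)) (at x)" for v
    unfolding D2_def by (rule smooth_on_has_derivative[OF smooth_on_fd[OF \<Psi>(1)] S(2)])
  have D3: "fd (\<lambda>y. fd (\<lambda>z. fd \<Psi> z v) y u) x t + (?C' (\<Psi> x) (?d u) (D2 t v) +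
        (?C' (\<Psi> x) (D2 t u) (?d v) + DC' (?d t) (?d u) (?d v))) =
      ?d (fd (\<lambda>y. ?C y u v) x t) + D2 t (?C x u v)" for t u v
  proof -
    \<comment> \<open>\<open>?C'\<close> has three moving arguments: the base point, the first and
      the second slot. They are released one at a time in 1, 2 and 3.\<close>
    have "((\<lambda>z. ?C' z p q) has_derivative (\<lambda>t. DC' t p q)) (at (\<Psi> x))" for p q
      unfolding DC'_def by (rule smooth_on_has_derivative[OF N.smooth_on_christoffel xV])
    from diff_chain_at[OF smooth_on_has_derivative[OF \<Psi>(1) S(2)] this]
    have 1: "((\<lambda>y. ?C' (\<Psi> y) p q) has_derivative (\<lambda>t. DC' (?d t) p q)) (at x)" for p q
      by (simp add: o_def)
    have "((\<lambda>y. ?C' (\<Psi> y) (fd \<Psi> y u) q) has_derivative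
        (\<lambda>t. ?C' (\<Psi> x) (D2 t u) q + fd (\<lambda>y. ?C' (\<Psi> y) (?d u) q) x t)) (at x)" for q
      by (rule has_derivative_linear_family[OF S(1,2), where L = "\<lambda>y p. ?C' (\<Psi> y) p q"])
        (use lin_C'(2) \<Psi>(2) deriv_d differentiableI[OF 1] in auto)
    then have 2: "((\<lambda>y. ?C' (\<Psi> y) (fd \<Psi> y u) q) has_derivative
        (\<lambda>t. ?C' (\<Psi> x) (D2 t u) q + DC' (?d t) (?d u) q)) (at x)" for q
      unfolding fd_eqI[OF 1] .
    have "((\<lambda>y. ?C' (\<Psi> y) (fd \<Psi> y u) (fd \<Psi> y v)) has_derivative
        (\<lambda>t. ?C' (\<Psi> x) (?d u) (D2 t v) + fd (\<lambda>y. ?C' (\<Psi> y) (fd \<Psi> y u) (?d v)) x t)) (at x)"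
      by (rule has_derivative_linear_family[OF S(1,2), where L = "\<lambda>y. ?C' (\<Psi> y) (fd \<Psi> y u)"])
        (use lin_C'(1) \<Psi>(2) deriv_d differentiableI[OF 2] in auto)
    then have 3: "((\<lambda>y. ?C' (\<Psi> y) (fd \<Psi> y u) (fd \<Psi> y v)) has_derivative
        (\<lambda>t. ?C' (\<Psi> x) (?d u) (D2 t v) + (?C' (\<Psi> x) (D2 t u) (?d v) + DC' (?d t) (?d u) (?d v)))) (at x)"
      unfolding fd_eqI[OF 2] .
    have lhs: "((\<lambda>y. fd (\<lambda>z. fd \<Psi> z v) y u + ?C' (\<Psi> y) (fd \<Psi> y u) (fd \<Psi> y v)) has_derivative
        (\<lambda>t. fd (\<lambda>y. fd (\<lambda>z. fd \<Psi> z v) y u) x t + (?C' (\<Psi> x) (?d u) (D2 t v) +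
          (?C' (\<Psi> x) (D2 t u) (?d v) + DC' (?d t) (?d u) (?d v))))) (at x)"
      by (intro has_derivative_add 3
          smooth_on_has_derivative[OF smooth_on_fd[OF smooth_on_fd[OF \<Psi>(1)]] S(2)])
    have "((\<lambda>y. fd \<Psi> y (?C y u v)) has_derivative
        (\<lambda>t. ?d (fd (\<lambda>y. ?C y u v) x t) + fd (\<lambda>y. fd \<Psi> y (?C x u v)) x t)) (at x)"
      by (rule has_derivative_linear_family[OF S(1,2) lin_d differentiableI[OF deriv_d]
            smooth_on_has_derivative[OF M.smooth_on_christoffel xU]])
    then have rhs: "((\<lambda>y. fd (\<lambda>z. fd \<Psi> z v) y u + ?C' (\<Psi> y) (fd \<Psi> y u) (fd \<Psi> y v)) has_derivative
        (\<lambda>t. ?d (fd (\<lambda>y. ?C y u v) x t) + D2 t (?C x u v))) (at x)"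
      unfolding D2_def
      by (rule has_derivative_transform_within_open[OF _ S(1,2)]) (rule gauss_formula[symmetric])
    from has_derivative_unique[OF lhs rhs] show ?thesis by (rule fun_cong)
  qed
  have comm: "fd (\<lambda>y. fd (\<lambda>z. fd \<Psi> z v) y u) x t = fd (\<lambda>y. fd (\<lambda>z. fd \<Psi> z v) y t) x u"
    by (rule smooth_on_fd_commute[OF S(1,2) smooth_on_fd[OF \<Psi>(1)]])
  have D2_sym: "D2 t u = D2 u t"
    unfolding D2 M.christoffel_sym[OF xU, of t u] N.christoffel_sym[OF xV, of "?d t" "?d u"] ..
  \<comment> \<open>Subtracting the instances of \<open>D3\<close> with \<open>t\<close> and
    \<open>u\<close> exchanged cancels the third derivatives and the terms with
    \<open>D2 t u\<close>. Inserting \<open>D2\<close> in what is left produces the quadratic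
    Christoffel terms of both curvatures.\<close>
  show ?thesis
    using arg_cong2[where f = "(-)", OF D3[of v u t] D3[of v t u, unfolded D2_sym[symmetric]]]
    unfolding M.curvature_eq[OF xU] N.curvature_eq[OF xV] DC'_def comm D2
      linear_diff[OF lin_d[OF S(2)]] linear_add[OF lin_d[OF S(2)]] linear_diff[OF lin_C'(1)[OF xV]]
    by (simp add: algebra_simps)
qed

section \<open>Curvature of a warped product\<close>

text \<open>The coordinate form of \<open>warped_metric\<close>: \<open>h\<close> is already a
  function of base coordinates, and projections instead of patterns suit differentiation.\<close>

definition warp :: "'a::euclidean_space metric \<Rightarrow> ('a \<Rightarrow> real) \<Rightarrow> 'b::euclidean_space metric \<Rightarrow> ('a \<times> 'b) metric" where
  "warp gB h gF = (\<lambda>p v w. gB (fst p) (fst v) (fst w) + (h (fst p))\<^sup>2 * gF (snd p) (snd v) (snd w))"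

lemma warp_apply: "warp gB h gF p v w =
    gB (fst p) (fst v) (fst w) + (h (fst p))\<^sup>2 * gF (snd p) (snd v) (snd w)"
  by (simp add: warp_def)

locale warped_chart = B: metric_chart U gB + F: metric_chart V gF
  for U :: "'a::euclidean_space set" and gB and V :: "'b::euclidean_space set" and gF +
  fixes h :: "'a \<Rightarrow> real"
  assumes h_smooth: "smooth_on U h" and h_pos: "x \<in> U \<Longrightarrow> 0 < h x"
begin

abbreviation "W \<equiv> warp gB h gF"

sublocale W: metric_chart "U \<times> V" W
proof
  show op: "open (U \<times> V)" using B.open_U F.open_U by (rule open_Times)
  have "bilinear (W p)" if "p \<in> U \<times> V" for p
  proof -
    have p: "fst p \<in> U" "snd p \<in> V" using that by auto
    note l = B.lin_left[OF p(1)] B.lin_right[OF p(1)] F.lin_left[OF p(2)] F.lin_right[OF p(2)]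
    show ?thesis
      unfolding bilinear_def warp_def
      by (intro conjI allI linearI)
        (simp_all add: linear_add[OF l(1)] linear_add[OF l(2)] linear_add[OF l(3)] linear_add[OF l(4)]
          linear_cmul[OF l(1)] linear_cmul[OF l(2)] linear_cmul[OF l(3)] linear_cmul[OF l(4)] algebra_simps)
  qed
  moreover have "W p v w = W p w v" if "p \<in> U \<times> V" for p v w
    using that B.sym[of "fst p" "fst v" "fst w"] F.sym[of "snd p" "snd v" "snd w"] by (auto simp: warp_def)
  moreover have "0 < W p v v" if p: "p \<in> U \<times> V" and v: "v \<noteq> 0" for p v
  proof -
    have nn: "0 \<le> gB (fst p) a a" "0 \<le> gF (snd p) b b" for a b
      using p B.pos[of "fst p" a] F.pos[of "snd p" b] linear_0[OF B.lin_left[of "fst p"]]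
        linear_0[OF F.lin_left[of "snd p"]] by (cases "a = 0"; cases "b = 0"; force)+
    have h2: "0 < (h (fst p))\<^sup>2" using h_pos[of "fst p"] p by auto
    show ?thesis
    proof (cases "fst v = 0")
      case True
      then have "snd v \<noteq> 0" using v by (simp add: prod_eq_iff)
      then have "0 < (h (fst p))\<^sup>2 * gF (snd p) (snd v) (snd v)"
        using h2 F.pos p by auto
      then show ?thesis using nn(1)[of "fst v"] by (simp add: warp_def)
    next
      case False
      then have "0 < gB (fst p) (fst v) (fst v)" using B.pos p by auto
      moreover have "0 \<le> (h (fst p))\<^sup>2 * gF (snd p) (snd v) (snd v)" using nn(2) by simp
      ultimately show ?thesis by (simp add: warp_def)
    qed
  qed
  moreover have "smooth_on (U \<times> V) (\<lambda>p. W p v w)" for v w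
  proof -
    have f: "smooth_on (U \<times> V) (\<lambda>p. k (fst p))" if "smooth_on U k" for k :: "'a \<Rightarrow> real"
      by (rule smooth_on_compose_linear[OF bounded_linear_fst op _ that]) auto
    have s: "smooth_on (U \<times> V) (\<lambda>p. k (snd p))" if "smooth_on V k" for k :: "'b \<Rightarrow> real"
      by (rule smooth_on_compose_linear[OF bounded_linear_snd op _ that]) auto
    show ?thesis
      unfolding warp_def power2_eq_square
      by (intro smooth_on_add smooth_on_mult op f[OF B.smooth] f[OF h_smooth] s[OF F.smooth])
  qed
  ultimately show "local_metric (U \<times> V) W" unfolding local_metric_def by blast
qed

text \<open>The last summand, from differentiating the square of \<open>h\<close>, is what
  distinguishes the connection from that of a direct product.\<close>

lemma fd_warp:
  assumes "x \<in> U" "y \<in> V"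
  shows "fd (\<lambda>q. W q v w) (x, y) u =
    fd (\<lambda>x. gB x (fst v) (fst w)) x (fst u) +
    ((h x)\<^sup>2 * fd (\<lambda>y. gF y (snd v) (snd w)) y (snd u) + 2 * h x * fd h x (fst u) * gF y (snd v) (snd w))"
proof -
  have f: "((\<lambda>p. k (fst p)) has_derivative (\<lambda>u. fd k x (fst u))) (at (x, y))"
    if "smooth_on U k" for k :: "'a \<Rightarrow> real"
    using diff_chain_at[OF bounded_linear_imp_has_derivative[OF bounded_linear_fst], of k "fd k x" "(x, y)"]
      smooth_on_has_derivative[OF that assms(1)] by (simp add: o_def)
  have s: "((\<lambda>p. k (snd p)) has_derivative (\<lambda>u. fd k y (snd u))) (at (x, y))"
    if "smooth_on V k" for k :: "'b \<Rightarrow> real"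
    using diff_chain_at[OF bounded_linear_imp_has_derivative[OF bounded_linear_snd], of k "fd k y" "(x, y)"]
      smooth_on_has_derivative[OF that assms(2)] by (simp add: o_def)
  have "((\<lambda>q. W q v w) has_derivative (\<lambda>u. fd (\<lambda>x. gB x (fst v) (fst w)) x (fst u) +
     (h (fst (x, y)) * h (fst (x, y)) * fd (\<lambda>y. gF y (snd v) (snd w)) y (snd u) +
      (h (fst (x, y)) * fd h x (fst u) + fd h x (fst u) * h (fst (x, y))) * gF (snd (x, y)) (snd v) (snd w)))) (at (x, y))"
    unfolding warp_def power2_eq_square
    by (intro has_derivative_add has_derivative_mult f s B.smooth F.smooth h_smooth)
  from fd_eqI[OF this] show ?thesis by (simp add: power2_eq_square algebra_simps)
qed

text \<open>The copies of the base are totally geodesic: for horizontal \<open>u\<close> and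
  \<open>v\<close>, each fibre term in the Koszul expression contains a zero fibre
  component.\<close>

lemma christoffel_warp_base:
  assumes "x \<in> U" "y \<in> V"
  shows "christoffel W (x, y) (a, 0) (a', 0) = (christoffel gB x a a', 0)"
proof (rule W.eq_if_inner_eq)
  show "(x, y) \<in> U \<times> V" using assms by simp
  fix z
  have "koszul W (x, y) (a, 0) (a', 0) z = koszul gB x a a' (fst z)"
    unfolding koszul_def fd_warp[OF assms]
    by (simp add: linear_0[OF F.lin_left[OF assms(2)]] linear_0[OF F.fd_metric_linear(1)[OF assms(2)]]
        linear_0[OF F.fd_metric_linear(2)[OF assms(2)]])
  then show "W (x, y) (christoffel W (x, y) (a, 0) (a', 0)) z = W (x, y) (christoffel gB x a a', 0) z"
    using assms W.christoffel_koszul[of "(x, y)" "(a, 0)" "(a', 0)" z]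
    by (simp add: warp_apply[of _ _ _ _ "(_, _)"] B.christoffel_koszul linear_0[OF F.lin_left[OF assms(2)]])
qed

text \<open>Of the three Koszul terms only the derivative along \<open>(a, 0)\<close> of the fibre
  product survives. Its factor \<open>h x * fd h x a\<close> becomes \<open>fd h x a / h x\<close>,
  since the fibre product in \<open>W\<close> carries the square of \<open>h x\<close>.\<close>

lemma christoffel_warp_mixed:
  assumes "x \<in> U" "y \<in> V"
  shows "christoffel W (x, y) (0, w) (a, 0) = (0, (fd h x a / h x) *\<^sub>R w)"
proof (rule W.eq_if_inner_eq)
  show "(x, y) \<in> U \<times> V" using assms by simp
  fix z
  have "koszul W (x, y) (0, w) (a, 0) z = h x * fd h x a * gF y w (snd z)"
    unfolding koszul_def fd_warp[OF assms]
    by (simp add: linear_0[OF F.lin_left[OF assms(2)]] linear_0[OF F.lin_right[OF assms(2)]]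
        linear_0[OF F.fd_metric_linear(1)[OF assms(2)]] linear_0[OF F.fd_metric_linear(2)[OF assms(2)]]
        linear_0[OF F.fd_metric_linear(3)[OF assms(2)]] linear_0[OF B.fd_metric_linear(1)[OF assms(1)]]
        linear_0[OF B.fd_metric_linear(2)[OF assms(1)]] linear_0[OF B.fd_metric_linear(3)[OF assms(1)]]
        linear_0[OF linear_frechet_derivative[OF smooth_on_differentiable[OF h_smooth assms(1)]]])
  then show "W (x, y) (christoffel W (x, y) (0, w) (a, 0)) z = W (x, y) (0, (fd h x a / h x) *\<^sub>R w) z"
    using assms h_pos[OF assms(1)] W.christoffel_koszul[of "(x, y)" "(0, w)" "(a, 0)" z]
    by (simp add: warp_apply[of _ _ _ _ "(_, _)"] linear_0[OF B.lin_left[OF assms(1)]]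
        linear_cmul[OF F.lin_left[OF assms(2)]] power2_eq_square)
qed

lemma curvature_warp_mixed:
  assumes x: "x \<in> U" and y: "y \<in> V"
  shows "curvature W (x, y) (0, w) (a, 0) (a, 0) =
    (0, ((fd h x (christoffel gB x a a) - fd (\<lambda>x. fd h x a) x a) / h x) *\<^sub>R w)"
proof -
  note hx = h_pos[OF x]
  have xy: "(x, y) \<in> U \<times> V" using x y by simp
  have fst': "(fst has_derivative fst) (at (x, y))"
    by (rule bounded_linear_imp_has_derivative[OF bounded_linear_fst])
  have "((\<lambda>q. christoffel gB (fst q) a a) has_derivative (\<lambda>t. fd (\<lambda>x. christoffel gB x a a) x (fst t))) (at (x, y))"
    using diff_chain_at[OF fst', of "\<lambda>x. christoffel gB x a a"]
      smooth_on_has_derivative[OF B.smooth_on_christoffel x] by (simp add: o_def)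
  from has_derivative_Pair[OF this has_derivative_const]
  have "((\<lambda>q. christoffel W q (a, 0) (a, 0)) has_derivative
      (\<lambda>t. (fd (\<lambda>x. christoffel gB x a a) x (fst t), 0))) (at (x, y))"
    by (rule has_derivative_transform_within_open[OF _ W.open_U xy]) (auto simp: christoffel_warp_base)
  \<comment> \<open>The horizontal symbol depends only on the base point, so its vertical derivative
    vanishes.\<close>
  then have 1: "fd (\<lambda>q. christoffel W q (a, 0) (a, 0)) (x, y) (0, w) = 0"
    using linear_0[OF linear_frechet_derivative[OF smooth_on_differentiable[OF B.smooth_on_christoffel x]]]
    by (simp add: fd_eqI zero_prod_def)
  have "((\<lambda>x. fd h x a / h x) has_derivative
      (\<lambda>t. (fd (\<lambda>x. fd h x a) x t * h x - fd h x a * fd h x t) / (h x * h x))) (at x)"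
    using hx by (intro has_derivative_divide' smooth_on_has_derivative[OF _ x] smooth_on_fd h_smooth) auto
  then have "((\<lambda>q. fd h (fst q) a / h (fst q)) has_derivative
      (\<lambda>t. (fd (\<lambda>x. fd h x a) x (fst t) * h x - fd h x a * fd h x (fst t)) / (h x * h x))) (at (x, y))"
    using diff_chain_at[OF fst', of "\<lambda>x. fd h x a / h x"] by (simp add: o_def)
  from has_derivative_Pair[OF has_derivative_const has_derivative_scaleR_left[OF this]]
  have "((\<lambda>q. christoffel W q (0, w) (a, 0)) has_derivative
      (\<lambda>t. (0, ((fd (\<lambda>x. fd h x a) x (fst t) * h x - fd h x a * fd h x (fst t)) / (h x * h x)) *\<^sub>R w)))
      (at (x, y))"
    by (rule has_derivative_transform_within_open[OF _ W.open_U xy]) (auto simp: christoffel_warp_mixed)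
  then have 2: "fd (\<lambda>q. christoffel W q (0, w) (a, 0)) (x, y) (a, 0) =
      (0, ((fd (\<lambda>x. fd h x a) x a * h x - fd h x a * fd h x a) / (h x * h x)) *\<^sub>R w)"
    by (simp add: fd_eqI)
  \<comment> \<open>Applying the mixed symbol twice gives the square of
    \<open>fd h x a / h x\<close>, which cancels the quotient-rule term in 2; what remains is the
    Hessian over \<open>h x\<close>.\<close>
  show ?thesis
    unfolding W.curvature_eq[OF xy] 1 2
    using hx
    by (simp add: christoffel_warp_base[OF x y] christoffel_warp_mixed[OF x y]
        W.christoffel_sym[OF xy, of "(a, 0)" "(0, _)"] scaleR_left_distrib[symmetric]
        scaleR_left_diff_distrib[symmetric] field_simps)
qed

end

section \<open>The Hessian of the warping function\<close>

context warped_chart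
begin

text \<open>Both expressions for the curvature of a mixed plane are images under
  \<open>fd \<Psi> (x, y)\<close> of multiples of one vertical vector \<open>(0, w)\<close>.
  Injectivity lets the two multiples be compared.\<close>

lemma hessian_eq_of_curvature:
  fixes \<Psi> :: "'a \<times> 'b \<Rightarrow> 'c::euclidean_space"
  assumes N: "metric_chart V' G'" and S: "open S" "(x, y) \<in> S" "S \<subseteq> U \<times> V"
    and \<Psi>: "smooth_on S \<Psi>" "\<Psi> ` S \<subseteq> V'" "inj (fd \<Psi> (x, y))"
    and tg: "\<And>z u v. z \<in> S \<Longrightarrow> second_fundamental_form W G' \<Psi> z u v = 0"
    and curv: "\<And>u v. curvature G' (\<Psi> (x, y)) (fd \<Psi> (x, y) u) (fd \<Psi> (x, y) v) (fd \<Psi> (x, y) v) =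
      k *\<^sub>R (W (x, y) v v *\<^sub>R fd \<Psi> (x, y) u - W (x, y) u v *\<^sub>R fd \<Psi> (x, y) v)"
  shows "fd h x (christoffel gB x a a) - fd (\<lambda>x. fd h x a) x a = k * h x * gB x a a"
proof -
  have xy: "x \<in> U" "y \<in> V" using S by auto
  \<comment> \<open>Positive dimension of the fibre enters here.\<close>
  obtain w :: 'b where w: "w \<in> Basis" by (meson nonempty_Basis ex_in_conv)
  have w0: "w \<noteq> 0" using w nonzero_Basis by blast
  define H where "H = (fd h x (christoffel gB x a a) - fd (\<lambda>x. fd h x a) x a) / h x"
  have d: "linear (fd \<Psi> (x, y))"
    using linear_frechet_derivative[OF smooth_on_differentiable[OF \<Psi>(1) S(2)]] .
  have W: "W (x, y) (a, 0) (a, 0) = gB x a a" "W (x, y) (0, w) (a, 0) = 0"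
    using linear_0[OF F.lin_right[OF xy(2)]] linear_0[OF B.lin_left[OF xy(1)]]
    by (simp_all add: warp_apply)
  have "fd \<Psi> (x, y) (0, H *\<^sub>R w) =
      curvature G' (\<Psi> (x, y)) (fd \<Psi> (x, y) (0, w)) (fd \<Psi> (x, y) (a, 0)) (fd \<Psi> (x, y) (a, 0))"
    unfolding H_def curvature_warp_mixed[OF xy, symmetric]
    by (rule gauss_equation_totally_geodesic[OF W.metric_chart_axioms N S \<Psi>(1,2) tg, symmetric])
  \<comment> \<open>The second term of \<open>curv\<close> drops out, as \<open>(0, w)\<close> and
    \<open>(a, 0)\<close> are orthogonal.\<close>
  also have "\<dots> = fd \<Psi> (x, y) ((k * gB x a a) *\<^sub>R (0, w))"
    unfolding curv W by (simp only: linear_cmul[OF d] scaleR_zero_left diff_zero scaleR_scaleR)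
  finally have "H *\<^sub>R w = (k * gB x a a) *\<^sub>R w"
    using \<Psi>(3) by (auto dest: injD)
  then have "H = k * gB x a a" using w0 by simp
  then show ?thesis using h_pos[OF xy(1)] by (simp add: H_def field_simps)
qed

end

section \<open>The Laplacian in terms of the Hessian\<close>

context metric_chart
begin


text \<open>The derivatives of the frame cancel, so that only the Hessian of \<open>h\<close> at \<open>x\<close> enters.\<close>

lemma frame_laplacian_of_hessian:
  assumes X: "open X" "x \<in> X" "X \<subseteq> U" and e: "orthonormal_frame G X e" and h: "smooth_on U h"
    and hess: "\<And>a. fd h x (christoffel G x a a) - fd (\<lambda>x. fd h x a) x a = c * G x a a"
  shows "frame_laplacian G e h x = real DIM('a) * c"
proof -
  have xU: "x \<in> U" using X by auto
  note dh = smooth_on_has_derivative[OF h xU]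
  have "dir_deriv (cov_deriv G (e k) (e k)) h x - dir_deriv (e k) (dir_deriv (e k) h) x = c"
    if k: "k < DIM('a)" for k
  proof -
    have e1: "G x (e k x) (e k x) = 1" and sm: "smooth_on X (e k)"
      using e k X(2) by (auto simp: orthonormal_frame_def)
    have "((\<lambda>y. fd h y (e k y)) has_derivative
        (\<lambda>t. fd h x (fd (e k) x t) + fd (\<lambda>y. fd h y (e k x)) x t)) (at x)"
      by (rule has_derivative_linear_family[OF open_U xU])
        (auto intro: linear_frechet_derivative smooth_on_differentiable[OF h] xU
          smooth_on_differentiable[OF smooth_on_fd[OF h]] smooth_on_has_derivative[OF sm X(2)])
    then have "dir_deriv (e k) (dir_deriv (e k) h) x =
        fd h x (fd (e k) x (e k x)) + fd (\<lambda>y. fd h y (e k x)) x (e k x)"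
      unfolding dir_deriv_def by (simp add: fd_eqI)
    moreover have "dir_deriv (cov_deriv G (e k) (e k)) h x =
        fd h x (fd (e k) x (e k x)) + fd h x (christoffel G x (e k x) (e k x))"
      unfolding dir_deriv_def cov_deriv_def by (rule linear_add[OF has_derivative_linear[OF dh]])
    ultimately show ?thesis using hess[of "e k x"] e1 by simp
  qed
  then show ?thesis by (simp add: frame_laplacian_def)
qed

end

section \<open>Charts and the Laplacian\<close>

lemma smooth_manifold_chart:
  assumes "smooth_manifold A"
  shows "open (fst (A i))" "open (chart_image A i)" "inj_on (snd (A i)) (fst (A i))"
    "\<And>Y. open Y \<Longrightarrow> Y \<subseteq> fst (A i) \<Longrightarrow> open (snd (A i) ` Y)"
    "\<exists>i. p \<in> fst (A i)"
proof -
  obtain \<theta> where o: "open (fst (A i))" "open (chart_image A i)"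
    and \<theta>: "homeomorphism (fst (A i)) (chart_image A i) (snd (A i)) \<theta>"
    using assms unfolding smooth_manifold_def by meson
  show "open (fst (A i))" "open (chart_image A i)" by fact+
  show "inj_on (snd (A i)) (fst (A i))"
    using \<theta> by (metis homeomorphism_def inj_on_inverseI)
  show "open (snd (A i) ` Y)" if "open Y" "Y \<subseteq> fst (A i)" for Y
    using homeomorphism_imp_open_map[OF \<theta>, of Y] o that by (simp add: openin_open_eq)
  show "\<exists>i. p \<in> fst (A i)"
    using assms unfolding smooth_manifold_def by blast
qed

lemma chart_inv_chart: "smooth_manifold A \<Longrightarrow> p \<in> fst (A i) \<Longrightarrow> chart_inv A i (snd (A i) p) = p"
  unfolding chart_inv_def by (rule inv_into_f_f[OF smooth_manifold_chart(3)])

lemma metric_chart_manifold: "riemannian_manifold A g \<Longrightarrow> metric_chart (chart_image A i) (g i)"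
  by (simp add: riemannian_manifold_def metric_chart_def smooth_manifold_chart(2))

lemma chart_inv_prod_atlas:
  assumes "smooth_manifold A" "smooth_manifold A'" "p \<in> fst (prod_atlas A A' ij)"
  shows "chart_inv (prod_atlas A A') ij (snd (prod_atlas A A' ij) p) = p"
proof -
  have "inj_on (snd (prod_atlas A A' ij)) (fst (prod_atlas A A' ij))"
    by (cases ij) (use map_prod_inj_on[OF smooth_manifold_chart(3)[OF assms(1)] smooth_manifold_chart(3)[OF assms(2)]]
      in \<open>simp add: prod_atlas_def\<close>)
  then show ?thesis unfolding chart_inv_def using assms(3) by (rule inv_into_f_f)
qed

text \<open>Makes the coordinate domain of a local representative of \<open>\<psi>\<close> open.
  Open sets of the product contain a rectangle around each point, and charts map its sides to open
  sets.\<close>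

lemma open_prod_chart:
  assumes "smooth_manifold A" "smooth_manifold A'" "open Y" "Y \<subseteq> fst (prod_atlas A A' (i, j))"
  shows "open (snd (prod_atlas A A' (i, j)) ` Y)"
proof (rule open_prod_intro)
  fix q assume "q \<in> snd (prod_atlas A A' (i, j)) ` Y"
  then obtain p where p: "p \<in> Y" "q = (snd (A i) (fst p), snd (A' j) (snd p))"
    by (auto simp: prod_atlas_def)
  obtain P Q where PQ: "open P" "open Q" "p \<in> P \<times> Q" "P \<times> Q \<subseteq> Y"
    using open_prod_elim[OF assms(3) p(1)] by blast
  have PQ': "P \<subseteq> fst (A i)" "Q \<subseteq> fst (A' j)"
    using PQ(3,4) assms(4) by (fastforce simp: prod_atlas_def)+
  have "q \<in> (snd (A i) ` P) \<times> (snd (A' j) ` Q)" using p PQ(3) by auto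
  moreover have "(snd (A i) ` P) \<times> (snd (A' j) ` Q) \<subseteq> snd (prod_atlas A A' (i, j)) ` Y"
    using PQ(4) by (force simp: prod_atlas_def)
  ultimately show "\<exists>P Q. open P \<and> open Q \<and> q \<in> P \<times> Q \<and> P \<times> Q \<subseteq> snd (prod_atlas A A' (i, j)) ` Y"
    using smooth_manifold_chart(4)[OF assms(1) PQ(1) PQ'(1)]
      smooth_manifold_chart(4)[OF assms(2) PQ(2) PQ'(2)] by blast
qed

lemma warped_metric_eq_warp:
  "warped_metric A gB f gF (i, j) = warp (gB i) (f \<circ> chart_inv A i) (gF j)"
  by (intro ext) (auto simp: warped_metric_def warp_def)

text \<open>The curvature formula is available for any local quaternionic basis, and the
  quaternionic Kaehler structure supplies one near \<open>\<Psi> z\<close>. On tangent vectors each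
  \<open>J\<close>-term has a factor pairing \<open>J \<alpha>\<close> of a tangent vector with a
  tangent vector, which is zero.\<close>

lemma space_form_curvature_totally_real:
  fixes AN :: "('k, 'n::{t2_space,second_countable_topology}, 'z::euclidean_space) atlas"
  assumes N: "quaternionic_space_form AN E gN c" and tr: "totally_real A AN E gN \<psi>"
    and z: "z \<in> local_dom A AN \<psi> i k" "local_rep A AN \<psi> i k z \<in> chart_image AN k"
  defines "\<Psi> \<equiv> local_rep A AN \<psi> i k"
  shows "curvature (gN k) (\<Psi> z) (fd \<Psi> z u) (fd \<Psi> z v) (fd \<Psi> z v) =
    (c / 4) *\<^sub>R (gN k (\<Psi> z) (fd \<Psi> z v) (fd \<Psi> z v) *\<^sub>R fd \<Psi> z u -
      gN k (\<Psi> z) (fd \<Psi> z u) (fd \<Psi> z v) *\<^sub>R fd \<Psi> z v)"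
proof -
  have "quaternionic_kaehler AN E gN" using N by (simp add: quaternionic_space_form_def)
  then obtain W J where W: "open W" "W \<subseteq> chart_image AN k" "\<Psi> z \<in> W"
    and J: "quaternionic_basis (gN k) (E k) W J"
    using z(2) unfolding quaternionic_kaehler_def \<Psi>_def by meson
  have orth: "gN k (\<Psi> z) (J \<alpha> (\<Psi> z) (fd \<Psi> z a)) (fd \<Psi> z b) = 0" if "\<alpha> \<in> {1..3}" for \<alpha> a b
  proof -
    have "J \<alpha> (\<Psi> z) ` range (fd \<Psi> z) \<subseteq> normal_space (gN k) \<Psi> z"
      using tr W J z(1) that unfolding totally_real_def \<Psi>_def by blast
    then show ?thesis unfolding normal_space_def by blast
  qed
  have "curvature (gN k) (\<Psi> z) a b d = (c / 4) *\<^sub>R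
       (gN k (\<Psi> z) b d *\<^sub>R a - gN k (\<Psi> z) a d *\<^sub>R b +
        (\<Sum>\<alpha>=1..3. gN k (\<Psi> z) (J \<alpha> (\<Psi> z) b) d *\<^sub>R J \<alpha> (\<Psi> z) a - gN k (\<Psi> z) (J \<alpha> (\<Psi> z) a) d *\<^sub>R J \<alpha> (\<Psi> z) b
           - (2 * gN k (\<Psi> z) (J \<alpha> (\<Psi> z) a) b) *\<^sub>R J \<alpha> (\<Psi> z) d))" for a b d
    using N W J unfolding quaternionic_space_form_def by blast
  then show ?thesis by (simp add: orth)
qed

theorem corollary3p13:
  fixes AB :: "('i, 'b::{t2_space,second_countable_topology}, 'x::euclidean_space) atlas"
    and gB :: "'i \<Rightarrow> 'x metric"
    and AF :: "('j, 'f::{t2_space,second_countable_topology}, 'y::euclidean_space) atlas"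
    and gF :: "'j \<Rightarrow> 'y metric"
    and f :: "'b \<Rightarrow> real"
    and AN :: "('k, 'n::{t2_space,second_countable_topology}, 'z::euclidean_space) atlas"
    and E :: "'k \<Rightarrow> 'z \<Rightarrow> ('z \<Rightarrow>\<^sub>L 'z) set"
    and gN :: "'k \<Rightarrow> 'z metric"
    and c :: real
    and \<psi> :: "'b \<times> 'f \<Rightarrow> 'n"
  assumes "riemannian_manifold AB gB"
    and "riemannian_manifold AF gF"
    and "smooth_fun AB f" and "\<And>p. 0 < f p"
    and "quaternionic_space_form AN E gN c"
    and "isometric_immersion (prod_atlas AB AF) (warped_metric AB gB f gF) AN gN \<psi>"
    and "totally_geodesic (prod_atlas AB AF) (warped_metric AB gB f gF) AN gN \<psi>"
    and "totally_real (prod_atlas AB AF) AN E gN \<psi>"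
  shows "\<forall>p. real DIM('x) * (c / 4) \<le> laplacian AB gB f p / f p \<and>
             laplacian AB gB f p / f p \<le> real DIM('x) * (c / 4)"
proof
  fix p
  let ?A = "prod_atlas AB AF" and ?g = "warped_metric AB gB f gF"
  have mB: "smooth_manifold AB" and mF: "smooth_manifold AF"
    using assms(1,2) by (simp_all add: riemannian_manifold_def)
  have rN: "riemannian_manifold AN gN"
    using assms(5) by (simp add: quaternionic_space_form_def quaternionic_kaehler_def)
  then have mN: "smooth_manifold AN" by (simp add: riemannian_manifold_def)
  \<comment> \<open>Stated for every chart and frame at \<open>p\<close>, as required by the
    definite description in \<open>laplacian\<close>.\<close>
  have frame: "frame_laplacian (gB i) e (f \<circ> chart_inv AB i) (snd (AB i) p) = real DIM('x) * (c / 4 * f p)"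
    if i: "p \<in> fst (AB i)" and X: "open X" "X \<subseteq> chart_image AB i" "snd (AB i) p \<in> X"
      and e: "orthonormal_frame (gB i) X e" for i X e
  proof -
    \<comment> \<open>Any fibre point will do: \<open>f\<close> and its Laplacian live on the
      base.\<close>
    obtain q :: 'f where True by blast
    obtain j where j: "q \<in> fst (AF j)" using smooth_manifold_chart(5)[OF mF] by blast
    obtain k where k: "\<psi> (p, q) \<in> fst (AN k)" using smooth_manifold_chart(5)[OF mN] by blast
    define x y h where "x = snd (AB i) p" and "y = snd (AF j) q" and "h = f \<circ> chart_inv AB i"
    define S where "S = local_dom ?A AN \<psi> (i, j) k"
    define \<Psi> where "\<Psi> = local_rep ?A AN \<psi> (i, j) k"
    have h: "smooth_on (chart_image AB i) h"
      using assms(3) by (simp add: smooth_fun_def h_def)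
    have hx: "h x = f p" by (simp add: h_def x_def chart_inv_chart[OF mB i])
    interpret warped_chart "chart_image AB i" "gB i" "chart_image AF j" "gF j" h
      by (intro warped_chart.intro warped_chart_axioms.intro metric_chart_manifold assms(1,2) h)
        (simp add: h_def assms(4))
    have g: "?g (i, j) = W" by (simp add: warped_metric_eq_warp h_def)
    have cont: "continuous_on UNIV \<psi>" and sm: "smooth_on S \<Psi>"
      using assms(6) by (auto simp: isometric_immersion_def smooth_map_def S_def \<Psi>_def)
    have iso: "gN k (\<Psi> z) (fd \<Psi> z u) (fd \<Psi> z v) = W z u v" and inj: "inj (fd \<Psi> z)" if "z \<in> S" for z u v
      using assms(6) that unfolding isometric_immersion_def S_def \<Psi>_def g[symmetric] by blast+
    have "open (fst (?A (i, j)))"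
      by (simp add: prod_atlas_def open_Times smooth_manifold_chart(1)[OF mB] smooth_manifold_chart(1)[OF mF])
    then have "open S"
      unfolding S_def local_dom_def
      by (intro open_prod_chart mB mF open_Int open_vimage smooth_manifold_chart(1)[OF mN] cont) auto
    have xyS: "(x, y) \<in> S"
      using i j k by (force simp: S_def local_dom_def prod_atlas_def x_def y_def)
    have SU: "S \<subseteq> chart_image AB i \<times> chart_image AF j"
      by (auto simp: S_def local_dom_def prod_atlas_def chart_image_def)
    have \<Psi>S: "\<Psi> ` S \<subseteq> chart_image AN k"
      by (auto simp: S_def \<Psi>_def local_dom_def local_rep_def chart_image_def
          chart_inv_prod_atlas[OF mB mF])
    have tg: "second_fundamental_form W (gN k) \<Psi> z u v = 0" if "z \<in> S" for z u v
      using assms(7) that unfolding totally_geodesic_def S_def \<Psi>_def g[symmetric] by blast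
    have curv: "curvature (gN k) (\<Psi> (x, y)) (fd \<Psi> (x, y) u) (fd \<Psi> (x, y) v) (fd \<Psi> (x, y) v) =
      (c / 4) *\<^sub>R (W (x, y) v v *\<^sub>R fd \<Psi> (x, y) u - W (x, y) u v *\<^sub>R fd \<Psi> (x, y) v)" for u v
      using space_form_curvature_totally_real[OF assms(5,8), of "(x, y)" "(i, j)" k u v] xyS \<Psi>S
      by (auto simp: iso[OF xyS] simp flip: \<Psi>_def S_def)
    \<comment> \<open>The factor \<open>f p\<close> is the value \<open>h x\<close> by which the
      curvature coefficient was divided.\<close>
    have "fd h x (christoffel (gB i) x a a) - fd (\<lambda>x. fd h x a) x a = (c / 4 * f p) * gB i x a a" for a
      using hessian_eq_of_curvature[OF metric_chart_manifold[OF rN] \<open>open S\<close> xyS SU sm \<Psi>S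
          inj[OF xyS] tg curv] by (simp add: hx)
    from B.frame_laplacian_of_hessian[OF X(1) _ X(2) e h this] X(3)
    show ?thesis by (simp add: x_def h_def)
  qed
  have "laplacian AB gB f p = real DIM('x) * (c / 4 * f p)"
    unfolding laplacian_def
  proof (rule the_equality)
    \<comment> \<open>Uniqueness needs at least one chart and frame at \<open>p\<close>; otherwise
      every \<open>l\<close> would satisfy the condition vacuously.\<close>
    obtain i where i: "p \<in> fst (AB i)" using smooth_manifold_chart(5)[OF mB] by blast
    obtain e where e: "orthonormal_frame (gB i) (chart_image AB i) e"
      using metric_chart.orthonormal_frame_exists[OF metric_chart_manifold[OF assms(1)]] by blast
    have "snd (AB i) p \<in> chart_image AB i" using i by (auto simp: chart_image_def)
    moreover fix l
    assume "\<forall>i W e. p \<in> fst (AB i) \<and> open W \<and> W \<subseteq> chart_image AB i \<and> snd (AB i) p \<in> W \<and>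
      orthonormal_frame (gB i) W e \<longrightarrow>
      l = frame_laplacian (gB i) e (f \<circ> chart_inv AB i) (snd (AB i) p)"
    ultimately show "l = real DIM('x) * (c / 4 * f p)"
      using i e smooth_manifold_chart(2)[OF mB] frame by (metis order_refl)
  qed (use frame in auto)
  then show "real DIM('x) * (c / 4) \<le> laplacian AB gB f p / f p \<and>
      laplacian AB gB f p / f p \<le> real DIM('x) * (c / 4)"
    using assms(4)[of p] by simp
qed

end
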